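(* Let $(M,g,v,\rho)$ be a Yamabe soliton whose vector field $v$ is a concurrent vector field on $M$. Then it is a gradient expanding Yamabe soliton with zero scalar curvature and $\rho=-1$; that is, $v=\nabla f$ for some function $f$ on $M$, $R=0$ and $\rho=-1$.
   Context: A Yamabe soliton $(M,g,v,\rho)$ is a Riemannian manifold $(M,g)$ with a vector field $v$ and a constant $\rho$ satisfying $(R-\rho)g=\frac{1}{2}\mathcal{L}_v g$, where $R$ is the scalar curvature of $(M,g)$ and $\mathcal{L}_v g$ is the Lie derivative of $g$ along $v$. It is called expanding if $\rho<0$, and gradient if $v$ is the gradient of some function $f$ on $M$. A vector field $v$ on $M$ is called concurrent if $\nabla_X v=X$ for every vector field $X$ on $M$, where $\nabla$ is the Levi-Civita connection of $(M,g)$. *)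

theory Defs
  imports "HOL-Analysis.Analysis"
begin

section \<open>Smooth functions on open subsets of Euclidean space\<close>

definition pd :: "'n::finite \<Rightarrow> (real^'n \<Rightarrow> real) \<Rightarrow> real^'n \<Rightarrow> real" where
  "pd i f x = frechet_derivative f (at x) (axis i 1)"

text \<open>On an open set, a function is of class C^(k+1) iff it is differentiable and all its
  partial derivatives are of class C^k. Both notions below are meant for open sets only.\<close>

primrec Ck_on :: "nat \<Rightarrow> (real^'n::finite) set \<Rightarrow> (real^'n \<Rightarrow> real) \<Rightarrow> bool" where
  "Ck_on 0 S f \<longleftrightarrow> continuous_on S f"
| "Ck_on (Suc k) S f \<longleftrightarrow> (\<forall>x\<in>S. f differentiable (at x)) \<and> (\<forall>i. Ck_on k S (pd i f))"

definition smooth_on :: "(real^'n::finite) set \<Rightarrow> (real^'n \<Rightarrow> real) \<Rightarrow> bool" where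
  "smooth_on S f \<longleftrightarrow> (\<forall>k. Ck_on k S f)"

section \<open>Smooth manifolds\<close>

text \<open>A chart is a pair of its domain and its coordinate map; the values of the coordinate map
  outside the domain are irrelevant. The dimension of the manifold is \<open>CARD('n)\<close>, which is
  arbitrary but positive.\<close>

type_synonym ('m, 'n) chart = "'m set \<times> ('m \<Rightarrow> real^'n)"

definition cdom :: "('m, 'n::finite) chart \<Rightarrow> 'm set" where
  "cdom c = fst c"

definition coord :: "('m, 'n::finite) chart \<Rightarrow> 'm \<Rightarrow> real^'n" where
  "coord c = snd c"

definition cimage :: "('m, 'n::finite) chart \<Rightarrow> (real^'n) set" where
  "cimage c = coord c ` cdom c"

definition cinv :: "('m, 'n::finite) chart \<Rightarrow> real^'n \<Rightarrow> 'm" where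
  "cinv c = inv_into (cdom c) (coord c)"

definition is_chart :: "'m topology \<Rightarrow> ('m, 'n::finite) chart \<Rightarrow> bool" where
  "is_chart X c \<longleftrightarrow>
     openin X (cdom c) \<and> open (cimage c) \<and>
     homeomorphic_map (subtopology X (cdom c)) (top_of_set (cimage c)) (coord c)"

definition overlap :: "('m, 'n::finite) chart \<Rightarrow> ('m, 'n) chart \<Rightarrow> (real^'n) set" where
  "overlap c c' = coord c ` (cdom c \<inter> cdom c')"

definition transition :: "('m, 'n::finite) chart \<Rightarrow> ('m, 'n) chart \<Rightarrow> real^'n \<Rightarrow> real^'n" where
  "transition c c' x = coord c' (cinv c x)"

definition jacobian :: "('m, 'n::finite) chart \<Rightarrow> ('m, 'n) chart \<Rightarrow> real^'n \<Rightarrow> real^'n^'n" where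
  "jacobian c c' x = (\<chi> i j. pd j (\<lambda>y. transition c c' y $ i) x)"

definition smooth_manifold :: "'m topology \<Rightarrow> ('m, 'n::finite) chart set \<Rightarrow> bool" where
  "smooth_manifold X A \<longleftrightarrow>
     topspace X \<noteq> {} \<and> Hausdorff_space X \<and> second_countable X \<and>
     (\<forall>c\<in>A. is_chart X c) \<and> (\<Union>c\<in>A. cdom c) = topspace X \<and>
     (\<forall>c\<in>A. \<forall>c'\<in>A. \<forall>i. smooth_on (overlap c c') (\<lambda>x. transition c c' x $ i))"

definition smooth_function :: "('m, 'n::finite) chart set \<Rightarrow> ('m \<Rightarrow> real) \<Rightarrow> bool" where
  "smooth_function A f \<longleftrightarrow> (\<forall>c\<in>A. smooth_on (cimage c) (f \<circ> cinv c))"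

section \<open>Vector fields and Riemannian metrics\<close>

text \<open>A tensor field is given by its components in every chart of the atlas, as functions of the
  coordinates, subject to the transformation law of its type on overlaps. Only the values at charts
  of the atlas and at points of the chart image matter.\<close>

type_synonym ('m, 'n) vfield = "('m, 'n) chart \<Rightarrow> real^'n \<Rightarrow> real^'n"
type_synonym ('m, 'n) bilinear_field = "('m, 'n) chart \<Rightarrow> real^'n \<Rightarrow> real^'n^'n"

definition smooth_vector_field :: "('m, 'n::finite) chart set \<Rightarrow> ('m, 'n) vfield \<Rightarrow> bool" where
  "smooth_vector_field A v \<longleftrightarrow>
     (\<forall>c\<in>A. \<forall>i. smooth_on (cimage c) (\<lambda>x. v c x $ i)) \<and>
     (\<forall>c\<in>A. \<forall>c'\<in>A. \<forall>x\<in>overlap c c'.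
        v c' (transition c c' x) = jacobian c c' x *v v c x)"

definition riemannian_metric :: "('m, 'n::finite) chart set \<Rightarrow> ('m, 'n) bilinear_field \<Rightarrow> bool" where
  "riemannian_metric A g \<longleftrightarrow>
     (\<forall>c\<in>A. \<forall>i j. smooth_on (cimage c) (\<lambda>x. g c x $ i $ j)) \<and>
     (\<forall>c\<in>A. \<forall>x\<in>cimage c. transpose (g c x) = g c x \<and> (\<forall>u. u \<noteq> 0 \<longrightarrow> u \<bullet> (g c x *v u) > 0)) \<and>
     (\<forall>c\<in>A. \<forall>c'\<in>A. \<forall>x\<in>overlap c c'.
        g c x = transpose (jacobian c c' x) ** g c' (transition c c' x) ** jacobian c c' x)"

definition riemannian_manifold ::
    "'m topology \<Rightarrow> ('m, 'n::finite) chart set \<Rightarrow> ('m, 'n) bilinear_field \<Rightarrow> bool" where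
  "riemannian_manifold X A g \<longleftrightarrow> smooth_manifold X A \<and> riemannian_metric A g"

definition gradient :: "('m, 'n::finite) bilinear_field \<Rightarrow> ('m \<Rightarrow> real) \<Rightarrow> ('m, 'n) vfield" where
  "gradient g f c x = matrix_inv (g c x) *v (\<chi> i. pd i (f \<circ> cinv c) x)"

section \<open>Levi-Civita connection, curvature and Lie derivative in local coordinates\<close>

text \<open>\<open>christoffel G k i j\<close> is the coefficient of the k-th coordinate field in the covariant
  derivative of the j-th coordinate field along the i-th one, for the Levi-Civita connection of the
  metric \<open>G\<close> on an open subset of Euclidean space.\<close>

definition christoffel ::
    "(real^'n::finite \<Rightarrow> real^'n^'n) \<Rightarrow> 'n \<Rightarrow> 'n \<Rightarrow> 'n \<Rightarrow> real^'n \<Rightarrow> real" where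
  "christoffel G k i j x =
     (1/2) * (\<Sum>l\<in>UNIV. matrix_inv (G x) $ k $ l *
       (pd i (\<lambda>y. G y $ j $ l) x + pd j (\<lambda>y. G y $ i $ l) x - pd l (\<lambda>y. G y $ i $ j) x))"

lemma pd_cong_open:
  assumes "open S" "x \<in> S" "\<And>y. y \<in> S \<Longrightarrow> f y = h y"
  shows "pd i f x = pd i h x"
proof -
  have "(f has_derivative D) (at x) \<longleftrightarrow> (h has_derivative D) (at x)" for D
    using assms has_derivative_transform_within_open[of f D x UNIV S h]
      has_derivative_transform_within_open[of h D x UNIV S f] by auto
  then show ?thesis
    by (simp add: pd_def frechet_derivative_def)
qed

text \<open>The Christoffel symbols are the only connection coefficients that are torsion-free and
  compatible with the metric.\<close>

lemma christoffel_levi_civita: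
  fixes G :: "real^'n::finite \<Rightarrow> real^'n^'n"
  assumes S: "open S" "x \<in> S" "\<And>y. y \<in> S \<Longrightarrow> transpose (G y) = G y"
    and inv: "invertible (G x)"
  shows "(\<forall>k i j. C k i j = C k j i) \<and>
         (\<forall>k i j. pd k (\<lambda>y. G y $ i $ j) x =
            (\<Sum>l\<in>UNIV. C l k i * G x $ l $ j) + (\<Sum>l\<in>UNIV. C l k j * G x $ i $ l)) \<longleftrightarrow>
         (\<forall>k i j. C k i j = christoffel G k i j x)"
proof -
  define d where "d k i j = pd k (\<lambda>y. G y $ i $ j) x" for k i j
  define H where "H = matrix_inv (G x)"
  define L where "L i j l = (\<Sum>k\<in>UNIV. C k i j * G x $ k $ l)" for i j l
  have Gsym: "G y $ i $ j = G y $ j $ i" if "y \<in> S" for y i j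
    using S(3)[OF that] by (metis transpose_def vec_lambda_beta)
  have dsym: "d k i j = d k j i" for k i j
    unfolding d_def by (rule pd_cong_open[OF S(1,2)]) (rule Gsym)
  have HG: "H ** G x = mat 1" and GH: "G x ** H = mat 1"
    using someI_ex[OF inv[unfolded invertible_def]] by (simp_all add: H_def matrix_inv_def)
  have "transpose H = transpose H ** (G x ** H)" by (simp add: GH)
  also have "\<dots> = transpose (G x ** H) ** H"
    by (simp add: matrix_transpose_mul S(3)[OF S(2)] matrix_mul_assoc)
  also have "\<dots> = H" by (simp add: GH transpose_mat)
  finally have Hsym: "H $ i $ j = H $ j $ i" for i j
    by (metis transpose_def vec_lambda_beta)
  have chr: "christoffel G k i j x = (1/2) * (\<Sum>l\<in>UNIV. H $ k $ l * (d i j l + d j i l - d l i j))"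
    for k i j by (simp add: christoffel_def d_def H_def)
  have key: "(\<forall>k. C k i j = christoffel G k i j x) \<longleftrightarrow>
        (\<forall>l. L i j l = (1/2) * (d i j l + d j i l - d l i j))" for i j
  proof -
    define c where "c = (\<chi> k. C k i j)"
    define w where "w = (\<chi> l. (1/2) * (d i j l + d j i l - d l i j))"
    have "(\<forall>k. C k i j = christoffel G k i j x) \<longleftrightarrow> c = H *v w"
      by (simp add: c_def w_def chr vec_eq_iff matrix_vector_mult_def sum_distrib_left mult_ac)
    also have "\<dots> \<longleftrightarrow> G x *v c = w"
      by (metis GH HG matrix_vector_mul_assoc matrix_vector_mul_lid)
    also have "\<dots> \<longleftrightarrow> (\<forall>l. L i j l = (1/2) * (d i j l + d j i l - d l i j))"
      unfolding vec_eq_iff matrix_vector_mult_def L_def c_def w_def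
      by (simp add: Gsym[OF S(2), of _ l for l] mult.commute)
    finally show ?thesis .
  qed
  have Lsym: "(\<forall>k i j. C k i j = C k j i) \<longleftrightarrow> (\<forall>l i j. L i j l = L j i l)"
  proof
    assume R: "\<forall>l i j. L i j l = L j i l"
    have rec: "C k i j = (\<Sum>l\<in>UNIV. L i j l * H $ l $ k)" for k i j
    proof -
      have "(\<chi> m. C m i j) v* (G x ** H) = (\<chi> m. C m i j)" by (simp add: GH)
      then have "((\<chi> m. C m i j) v* G x) v* H = (\<chi> m. C m i j)"
        by (simp add: vector_matrix_mul_assoc)
      then have "(((\<chi> m. C m i j) v* G x) v* H) $ k = C k i j" by simp
      then show ?thesis by (simp add: vector_matrix_mult_def L_def mult_ac)
    qed
    show "\<forall>k i j. C k i j = C k j i" using R by (simp add: rec)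
  qed (simp add: L_def)
  have met: "(\<Sum>l\<in>UNIV. C l k i * G x $ l $ j) + (\<Sum>l\<in>UNIV. C l k j * G x $ i $ l)
      = L k i j + L k j i" for k i j
    by (simp add: L_def Gsym[OF S(2), of i])
  have "(\<forall>k i j. C k i j = christoffel G k i j x) \<longleftrightarrow>
      (\<forall>i j l. L i j l = (1/2) * (d i j l + d j i l - d l i j))"
    using key by metis
  also have "\<dots> \<longleftrightarrow> (\<forall>l i j. L i j l = L j i l) \<and> (\<forall>k i j. d k i j = L k i j + L k j i)"
  proof
    assume R: "\<forall>i j l. L i j l = (1/2) * (d i j l + d j i l - d l i j)"
    have "L i j l = L j i l" for i j l
      using R[rule_format, of i j l] R[rule_format, of j i l] dsym[of l i j] by simp
    moreover have "d k i j = L k i j + L k j i" for k i j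
      using R[rule_format, of k i j] R[rule_format, of k j i]
        dsym[of k i j] dsym[of i k j] dsym[of j k i] by simp
    ultimately show "(\<forall>l i j. L i j l = L j i l) \<and> (\<forall>k i j. d k i j = L k i j + L k j i)"
      by blast
  next
    assume R: "(\<forall>l i j. L i j l = L j i l) \<and> (\<forall>k i j. d k i j = L k i j + L k j i)"
    show "\<forall>i j l. L i j l = (1/2) * (d i j l + d j i l - d l i j)"
    proof (intro allI)
      fix i j l
      have "d i j l = L i j l + L i l j" "d j i l = L j i l + L j l i" "d l i j = L l i j + L l j i"
        "L i j l = L j i l" "L l i j = L i l j" "L l j i = L j l i" using R by blast+
      then show "L i j l = (1/2) * (d i j l + d j i l - d l i j)" by simp
    qed
  qed
  finally show ?thesis unfolding met Lsym d_def by blast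
qed

definition covariant_derivative ::
    "('m, 'n::finite) bilinear_field \<Rightarrow> ('m, 'n) vfield \<Rightarrow> ('m, 'n) vfield \<Rightarrow> ('m, 'n) vfield" where
  "covariant_derivative g Y v c x =
     (\<chi> k. \<Sum>i\<in>UNIV. Y c x $ i *
        (pd i (\<lambda>y. v c y $ k) x + (\<Sum>j\<in>UNIV. christoffel (g c) k i j x * v c x $ j)))"

text \<open>\<open>riemann G l k i j\<close> is the l-th component of R(e_i, e_j) e_k, where e_i is the i-th coordinate
  field and R(X, Y) Z = D_X D_Y Z - D_Y D_X Z - D_[X,Y] Z. Then \<open>ricci G j k\<close> is the trace of
  X \<open>\<mapsto>\<close> R(X, e_j) e_k, so that round spheres have positive scalar curvature.\<close>

definition riemann ::
    "(real^'n::finite \<Rightarrow> real^'n^'n) \<Rightarrow> 'n \<Rightarrow> 'n \<Rightarrow> 'n \<Rightarrow> 'n \<Rightarrow> real^'n \<Rightarrow> real" where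
  "riemann G l k i j x =
     pd i (christoffel G l j k) x - pd j (christoffel G l i k) x +
     (\<Sum>m\<in>UNIV. christoffel G l i m x * christoffel G m j k x
               - christoffel G l j m x * christoffel G m i k x)"

definition ricci :: "(real^'n::finite \<Rightarrow> real^'n^'n) \<Rightarrow> 'n \<Rightarrow> 'n \<Rightarrow> real^'n \<Rightarrow> real" where
  "ricci G j k x = (\<Sum>i\<in>UNIV. riemann G i k i j x)"

definition scalar_curvature ::
    "('m, 'n::finite) bilinear_field \<Rightarrow> ('m, 'n) chart \<Rightarrow> real^'n \<Rightarrow> real" where
  "scalar_curvature g c x =
     (\<Sum>j\<in>UNIV. \<Sum>k\<in>UNIV. matrix_inv (g c x) $ j $ k * ricci (g c) j k x)"

text \<open>Components of the Lie derivative of \<open>g\<close> along \<open>v\<close>, that is,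
  (L_v g)(X, Y) = v(g(X, Y)) - g([v, X], Y) - g(X, [v, Y]) evaluated on the coordinate fields.\<close>

definition lie_derivative ::
    "('m, 'n::finite) vfield \<Rightarrow> ('m, 'n) bilinear_field \<Rightarrow> ('m, 'n) bilinear_field" where
  "lie_derivative v g c x =
     (\<chi> i j. \<Sum>k\<in>UNIV. v c x $ k * pd k (\<lambda>y. g c y $ i $ j) x
        + g c x $ k $ j * pd i (\<lambda>y. v c y $ k) x
        + g c x $ i $ k * pd j (\<lambda>y. v c y $ k) x)"

section \<open>Yamabe solitons and concurrent vector fields\<close>

definition yamabe_soliton ::
    "'m topology \<Rightarrow> ('m, 'n::finite) chart set \<Rightarrow> ('m, 'n) bilinear_field \<Rightarrow> ('m, 'n) vfield
      \<Rightarrow> real \<Rightarrow> bool" where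
  "yamabe_soliton X A g v \<rho> \<longleftrightarrow>
     riemannian_manifold X A g \<and> smooth_vector_field A v \<and>
     (\<forall>c\<in>A. \<forall>x\<in>cimage c.
        (scalar_curvature g c x - \<rho>) *\<^sub>R g c x = (1/2) *\<^sub>R lie_derivative v g c x)"

definition expanding_yamabe_soliton ::
    "'m topology \<Rightarrow> ('m, 'n::finite) chart set \<Rightarrow> ('m, 'n) bilinear_field \<Rightarrow> ('m, 'n) vfield
      \<Rightarrow> real \<Rightarrow> bool" where
  "expanding_yamabe_soliton X A g v \<rho> \<longleftrightarrow> yamabe_soliton X A g v \<rho> \<and> \<rho> < 0"

definition gradient_yamabe_soliton ::
    "'m topology \<Rightarrow> ('m, 'n::finite) chart set \<Rightarrow> ('m, 'n) bilinear_field \<Rightarrow> ('m, 'n) vfield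
      \<Rightarrow> real \<Rightarrow> bool" where
  "gradient_yamabe_soliton X A g v \<rho> \<longleftrightarrow>
     yamabe_soliton X A g v \<rho> \<and>
     (\<exists>f. smooth_function A f \<and> (\<forall>c\<in>A. \<forall>x\<in>cimage c. v c x = gradient g f c x))"

definition concurrent ::
    "('m, 'n::finite) chart set \<Rightarrow> ('m, 'n) bilinear_field \<Rightarrow> ('m, 'n) vfield \<Rightarrow> bool" where
  "concurrent A g v \<longleftrightarrow>
     smooth_vector_field A v \<and>
     (\<forall>Y. smooth_vector_field A Y \<longrightarrow>
        (\<forall>c\<in>A. \<forall>x\<in>cimage c. covariant_derivative g Y v c x = Y c x))"

end

theory Submission
  imports Defs
begin

text \<open>For a concurrent field the Lie derivative of the metric is twice the symmetric part of
  \<open>\<nabla>v = id\<close>, so \<open>L\<^sub>v g = 2 g\<close> (\<open>lie_derivative_metric\<close>). The soliton equation becomes \<open>(R - \<rho>) g = g\<close>, and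
  the scalar curvature is the constant \<open>\<rho> + 1\<close>. On the other hand \<open>v\<close> is homothetic, so it rescales the
  scalar curvature: \<open>v(R) = - 2 R\<close> (\<open>dv_scal\<close>). A constant with this property is 0, hence \<open>R = 0\<close> and
  \<open>\<rho> = -1\<close>. The potential of \<open>v\<close> is \<open>f = g(v, v) / 2\<close>, because \<open>df(X) = g(\<nabla>\<^sub>X v, v) = g(X, v)\<close>
  (\<open>pd_energy\<close>).

  The formula \<open>v(R) = - 2 R\<close> is derived without flows. Concurrency implies \<open>R(X, Y) v = 0\<close> (\<open>F_v\<close>), and the
  algebraic symmetries of the curvature turn this into \<open>R(v, X) = 0\<close> (\<open>v_F\<close>). Differentiating the latter
  and inserting the result into the second Bianchi identity gives the derivative of the curvature
  along \<open>v\<close> in terms of the curvature itself (\<open>dv_F\<close>); two traces lead to the scalar curvature. In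
  coordinates all of this rests on the symmetry of second derivatives (\<open>pd_commute\<close>).

  These computations need \<open>\<nabla>\<^sub>X v = X\<close> for the coordinate fields of a chart, while concurrency only
  provides it for vector fields on the whole manifold. The two are linked by bump functions: every
  coordinate vector at a point is, up to a nonzero factor, the value of a smooth global field
  (\<open>bump_coordinate_field\<close>).\<close>

section \<open>Rules for partial derivatives\<close>

lemma pd_eqI: "(f has_derivative D) (at x) \<Longrightarrow> pd i f x = D (axis i 1)"
  by (metis frechet_derivative_at pd_def)

lemma has_derivative_pd:
  fixes f :: "real^'n::finite \<Rightarrow> real"
  assumes "f differentiable (at x)"
  shows "(f has_derivative (\<lambda>h. \<Sum>j\<in>UNIV. h $ j * pd j f x)) (at x)"
proof -
  obtain D where D: "(f has_derivative D) (at x)"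
    using assms by (auto simp: differentiable_def)
  interpret linear D using D by (rule has_derivative_linear)
  have "D h = (\<Sum>j\<in>UNIV. h $ j * pd j f x)" for h
  proof -
    have "D h = D (\<Sum>j\<in>UNIV. h $ j *\<^sub>R axis j 1)"
      using basis_expansion[of h] by (simp add: scalar_mult_eq_scaleR)
    also have "\<dots> = (\<Sum>j\<in>UNIV. h $ j * pd j f x)"
      by (simp add: sum scale pd_eqI[OF D])
    finally show ?thesis .
  qed
  then have "D = (\<lambda>h. \<Sum>j\<in>UNIV. h $ j * pd j f x)" by blast
  then show ?thesis using D by simp
qed

lemma pd_const [simp]: "pd i (\<lambda>y. a) x = 0"
  by (rule pd_eqI[OF has_derivative_const])

lemma pd_component: "pd i (\<lambda>y. y $ j) x = (if i = j then 1 else 0)"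
proof -
  have "((\<lambda>y::real^'a. y $ j) has_derivative (\<lambda>h. h $ j)) (at x)"
    by (rule bounded_linear.has_derivative[OF bounded_linear_vec_nth has_derivative_ident])
  from pd_eqI[OF this] show ?thesis by (auto simp: axis_def)
qed

lemma pd_add:
  "f differentiable (at x) \<Longrightarrow> h differentiable (at x) \<Longrightarrow>
    pd i (\<lambda>y. f y + h y) x = pd i f x + pd i h x"
  by (rule trans[OF pd_eqI[OF has_derivative_add[OF has_derivative_pd has_derivative_pd]]])
     (auto simp: axis_def if_distrib if_distribR sum.delta cong: if_cong)

lemma pd_mult:
  "f differentiable (at x) \<Longrightarrow> h differentiable (at x) \<Longrightarrow>
    pd i (\<lambda>y. f y * h y) x = pd i f x * h x + f x * pd i h x"
  by (rule trans[OF pd_eqI[OF has_derivative_mult[OF has_derivative_pd has_derivative_pd]]])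
     (auto simp: axis_def if_distrib if_distribR sum.delta cong: if_cong)

lemma pd_cmult:
  "f differentiable (at x) \<Longrightarrow> pd i (\<lambda>y. a * f y) x = a * pd i f x"
  using pd_mult[of "\<lambda>y. a" x f i] by simp

lemma pd_diff:
  "f differentiable (at x) \<Longrightarrow> h differentiable (at x) \<Longrightarrow>
    pd i (\<lambda>y. f y - h y) x = pd i f x - pd i h x"
  by (rule trans[OF pd_eqI[OF has_derivative_diff[OF has_derivative_pd has_derivative_pd]]])
     (auto simp: axis_def if_distrib if_distribR sum.delta cong: if_cong)

lemma pd_sum:
  assumes "\<And>a. a \<in> I \<Longrightarrow> f a differentiable (at x)"
  shows "pd i (\<lambda>y. \<Sum>a\<in>I. f a y) x = (\<Sum>a\<in>I. pd i (f a) x)"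
  by (rule trans[OF pd_eqI[OF has_derivative_sum[OF has_derivative_pd[OF assms]]]])
     (auto simp: axis_def if_distrib if_distribR sum.delta cong: if_cong)

lemma pd_inverse:
  fixes f :: "real^'n::finite \<Rightarrow> real"
  assumes "f differentiable (at x)" "f x \<noteq> 0"
  shows "pd i (\<lambda>y. inverse (f y)) x = - (inverse (f x) * inverse (f x) * pd i f x)"
  by (rule trans[OF pd_eqI[OF Deriv.has_derivative_inverse[OF assms(2) has_derivative_pd[OF
      assms(1)]]]])
     (auto simp: axis_def if_distrib if_distribR sum.delta cong: if_cong)

lemma pd_compose:
  fixes T :: "real^'n::finite \<Rightarrow> real^'m::finite"
  assumes T: "\<And>j. (\<lambda>y. T y $ j) differentiable (at x)" and f: "f differentiable (at (T x))"
  shows "(\<lambda>y. f (T y)) differentiable (at x)"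
    and "pd i (\<lambda>y. f (T y)) x = (\<Sum>j\<in>UNIV. pd j f (T x) * pd i (\<lambda>y. T y $ j) x)"
proof -
  define D where "D = (\<lambda>h. \<chi> j. \<Sum>l\<in>UNIV. h $ l * pd l (\<lambda>y. T y $ j) x)"
  have d: "((\<lambda>y. \<Sum>j\<in>UNIV. (T y $ j) *\<^sub>R (axis j 1 :: real^'m)) has_derivative
      (\<lambda>h. \<Sum>j\<in>UNIV. (\<Sum>l\<in>UNIV. h $ l * pd l (\<lambda>y. T y $ j) x) *\<^sub>R axis j 1)) (at x)"
    by (intro has_derivative_sum has_derivative_scaleR_left has_derivative_pd T)
  have expand: "(\<Sum>j\<in>UNIV. u $ j *\<^sub>R axis j 1) = u" for u :: "real^'m"
    using basis_expansion[of u] by (simp add: scalar_mult_eq_scaleR)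
  have eqD: "(\<lambda>h. \<Sum>j\<in>UNIV. (\<Sum>l\<in>UNIV. h $ l * pd l (\<lambda>y. T y $ j) x) *\<^sub>R axis j 1) = D"
    using expand[of "D h" for h] by (simp add: D_def)
  have eqT: "(\<lambda>y. \<Sum>j\<in>UNIV. T y $ j *\<^sub>R axis j 1) = T"
    by (rule ext) (rule expand)
  have "(T has_derivative D) (at x)"
    using d unfolding eqT eqD .
  from has_derivative_compose[OF this has_derivative_pd[OF f]]
  have c: "((\<lambda>y. f (T y)) has_derivative (\<lambda>h. \<Sum>j\<in>UNIV. D h $ j * pd j f (T x))) (at x)"
    by simp
  then show "(\<lambda>y. f (T y)) differentiable (at x)" by (auto simp: differentiable_def)
  show "pd i (\<lambda>y. f (T y)) x = (\<Sum>j\<in>UNIV. pd j f (T x) * pd i (\<lambda>y. T y $ j) x)"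
    unfolding pd_eqI[OF c] D_def
    by (simp add: axis_def if_distrib if_distribR sum.delta mult.commute[of "pd _ f _"] cong: if_cong)
qed

section \<open>Closure properties of smooth functions\<close>

lemma differentiable_cong_open:
  assumes "open S" "x \<in> S" "\<And>y. y \<in> S \<Longrightarrow> f y = h y" "f differentiable (at x)"
  shows "h differentiable (at x)"
  using assms has_derivative_transform_within_open[of f _ x UNIV S h]
  unfolding differentiable_def by auto

text \<open>The recursion defining \<open>Ck_on\<close> differentiates a function as a map on the whole space, but on an
  open set only its values there enter, because partial derivatives are local.\<close>

lemma Ck_on_cong:
  "open S \<Longrightarrow> (\<And>y. y \<in> S \<Longrightarrow> f y = h y) \<Longrightarrow> Ck_on k S f \<Longrightarrow> Ck_on k S h"
proof (induction k arbitrary: f h)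
  case 0 then show ?case using continuous_on_cong[of S S f h] by simp
next
  case (Suc k)
  have "Ck_on k S (pd i h)" for i
    by (rule Suc.IH[of "pd i f"]) (use Suc.prems in \<open>auto intro: pd_cong_open\<close>)
  then show ?case using Suc.prems differentiable_cong_open[of S _ f h] by auto
qed

lemma Ck_on_Suc_imp: "Ck_on (Suc k) S f \<Longrightarrow> Ck_on k S f"
proof (induction k arbitrary: f)
  case 0
  then show ?case
    by (auto simp: intro!: continuous_at_imp_continuous_on differentiable_imp_continuous_within)
qed auto

lemma Ck_on_subset: "Ck_on k S f \<Longrightarrow> T \<subseteq> S \<Longrightarrow> Ck_on k T f"
  by (induction k arbitrary: f) (auto intro: continuous_on_subset)

lemma Ck_on_Un:
  "open S \<Longrightarrow> open T \<Longrightarrow> Ck_on k S f \<Longrightarrow> Ck_on k T f \<Longrightarrow> Ck_on k (S \<union> T) f"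
  by (induction k arbitrary: f) (auto intro: continuous_on_open_Un)

lemma Ck_on_const: "Ck_on k S (\<lambda>x. a)"
proof (induction k arbitrary: a)
  case (Suc k)
  have "pd i (\<lambda>x. a) = (\<lambda>x. 0)" for i :: 'a by auto
  with Suc show ?case by simp
qed auto

lemma Ck_on_component: "Ck_on k S (\<lambda>x. x $ j)"
proof (cases k)
  case (Suc k)
  have "pd i (\<lambda>x::real^'a. x $ j) = (\<lambda>x. if i = j then 1 else 0)" for i
    by (auto simp: pd_component)
  with Suc show ?thesis
    by (auto simp: Ck_on_const intro!: bounded_linear_imp_differentiable bounded_linear_vec_nth)
qed (auto intro: continuous_on_add continuous_on_mult continuous_on_inverse continuous_on_component)

lemma Ck_on_add:
  "open S \<Longrightarrow> Ck_on k S f \<Longrightarrow> Ck_on k S h \<Longrightarrow> Ck_on k S (\<lambda>x. f x + h x)"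
proof (induction k arbitrary: f h)
  case (Suc k)
  have "Ck_on k S (pd i (\<lambda>x. f x + h x))" for i
    by (rule Ck_on_cong[OF \<open>open S\<close> _ Suc.IH[of "pd i f" "pd i h"]])
       (use Suc.prems in \<open>auto simp: pd_add\<close>)
  with Suc.prems show ?case by (auto intro: differentiable_add)
qed (auto intro: continuous_on_add continuous_on_mult continuous_on_inverse continuous_on_component)

lemma Ck_on_mult:
  "open S \<Longrightarrow> Ck_on k S f \<Longrightarrow> Ck_on k S h \<Longrightarrow> Ck_on k S (\<lambda>x. f x * h x)"
proof (induction k arbitrary: f h)
  case (Suc k)
  have "Ck_on k S (pd i (\<lambda>x. f x * h x))" for i
  proof (rule Ck_on_cong[OF \<open>open S\<close> _ Ck_on_add])
    have "Ck_on k S f" "Ck_on k S h" using Suc.prems Ck_on_Suc_imp by blast+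
    then show "Ck_on k S (\<lambda>x. pd i f x * h x)" "Ck_on k S (\<lambda>x. f x * pd i h x)"
      using Suc.prems by (auto intro: Suc.IH)
  qed (use Suc.prems in \<open>auto simp: pd_mult\<close>)
  with Suc.prems show ?case by auto
qed (auto intro: continuous_on_add continuous_on_mult continuous_on_inverse continuous_on_component)

lemma Ck_on_inverse:
  "open S \<Longrightarrow> Ck_on k S f \<Longrightarrow> (\<And>x. x \<in> S \<Longrightarrow> f x \<noteq> 0) \<Longrightarrow> Ck_on k S (\<lambda>x. inverse (f x))"
proof (induction k)
  case (Suc k)
  have f: "Ck_on k S f" using Suc.prems Ck_on_Suc_imp by blast
  have "Ck_on k S (pd i (\<lambda>x. inverse (f x)))" for i
  proof (rule Ck_on_cong[OF \<open>open S\<close>])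
    show "Ck_on k S (\<lambda>x. (-1) * (inverse (f x) * inverse (f x) * pd i f x))"
      using Suc f by (intro Ck_on_mult Ck_on_const) auto
  qed (use Suc.prems in \<open>auto simp: pd_inverse\<close>)
  with Suc.prems show ?case by (auto intro: differentiable_inverse)
qed (auto intro: continuous_on_add continuous_on_mult continuous_on_inverse continuous_on_component)

lemma smooth_on_cong:
  "open S \<Longrightarrow> (\<And>y. y \<in> S \<Longrightarrow> f y = h y) \<Longrightarrow> smooth_on S f \<Longrightarrow> smooth_on S h"
  unfolding smooth_on_def using Ck_on_cong by blast

lemma smooth_on_subset: "smooth_on S f \<Longrightarrow> T \<subseteq> S \<Longrightarrow> smooth_on T f"
  unfolding smooth_on_def using Ck_on_subset by blast

lemma smooth_on_Un:
  "open S \<Longrightarrow> open T \<Longrightarrow> smooth_on S f \<Longrightarrow> smooth_on T f \<Longrightarrow> smooth_on (S \<union> T) f"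
  unfolding smooth_on_def using Ck_on_Un by blast

lemma smooth_on_const: "smooth_on S (\<lambda>x. a)"
  by (simp add: smooth_on_def Ck_on_const)

lemma smooth_on_component: "smooth_on S (\<lambda>x. x $ j)"
  by (simp add: smooth_on_def Ck_on_component)

lemma smooth_on_add:
  "open S \<Longrightarrow> smooth_on S f \<Longrightarrow> smooth_on S h \<Longrightarrow> smooth_on S (\<lambda>x. f x + h x)"
  by (simp add: smooth_on_def Ck_on_add)

lemma smooth_on_mult:
  "open S \<Longrightarrow> smooth_on S f \<Longrightarrow> smooth_on S h \<Longrightarrow> smooth_on S (\<lambda>x. f x * h x)"
  by (simp add: smooth_on_def Ck_on_mult)

lemma smooth_on_diff:
  assumes "open S" "smooth_on S f" "smooth_on S h"
  shows "smooth_on S (\<lambda>x. f x - h x)"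
  using smooth_on_add[OF assms(1,2) smooth_on_mult[OF assms(1) smooth_on_const[of _ "-1"] assms(3)]]
  by simp

lemma smooth_on_inverse:
  "open S \<Longrightarrow> smooth_on S f \<Longrightarrow> (\<And>x. x \<in> S \<Longrightarrow> f x \<noteq> 0) \<Longrightarrow> smooth_on S (\<lambda>x. inverse (f x))"
  by (simp add: smooth_on_def Ck_on_inverse)

lemma smooth_on_sum:
  "open S \<Longrightarrow> (\<And>a. a \<in> I \<Longrightarrow> smooth_on S (f a)) \<Longrightarrow> smooth_on S (\<lambda>x. \<Sum>a\<in>I. f a x)"
  by (induction I rule: infinite_finite_induct) (auto intro: smooth_on_const smooth_on_add)

lemma smooth_on_prod:
  "open S \<Longrightarrow> (\<And>a. a \<in> I \<Longrightarrow> smooth_on S (f a)) \<Longrightarrow> smooth_on S (\<lambda>x. \<Prod>a\<in>I. f a x)"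
  by (induction I rule: infinite_finite_induct) (auto intro: smooth_on_const smooth_on_mult)

lemma smooth_on_pd: "smooth_on S f \<Longrightarrow> smooth_on S (pd i f)"
  unfolding smooth_on_def by (metis Ck_on.simps(2))

lemma smooth_on_differentiable: "smooth_on S f \<Longrightarrow> x \<in> S \<Longrightarrow> f differentiable (at x)"
  unfolding smooth_on_def by (metis Ck_on.simps(2))

lemma smooth_on_continuous_on: "smooth_on S f \<Longrightarrow> continuous_on S f"
  unfolding smooth_on_def by (metis Ck_on.simps(1))

text \<open>By the chain rule the partial derivatives of \<open>f \<circ> T\<close> are sums of products of \<open>pd j f \<circ> T\<close> with
  smooth functions, so one induction on the order of differentiability suffices if \<open>f\<close> is
  generalized in it while the smooth map \<open>T\<close> stays fixed.\<close>

lemma smooth_on_compose: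
  fixes T :: "real^'n::finite \<Rightarrow> real^'m::finite"
  assumes S: "open S" and T: "\<And>j. smooth_on S (\<lambda>x. T x $ j)" and V: "T ` S \<subseteq> V"
    and f: "smooth_on V f"
  shows "smooth_on S (\<lambda>x. f (T x))"
proof -
  have "Ck_on k V f \<Longrightarrow> Ck_on k S (\<lambda>x. f (T x))" for k f
  proof (induction k arbitrary: f)
    case 0
    have "continuous_on S T"
      using continuous_on_vec_lambda[of S "\<lambda>j x. T x $ j"] smooth_on_continuous_on[OF T]
      by simp
    with 0 V show ?case by (auto intro: continuous_on_compose2)
  next
    case (Suc k)
    have dT: "(\<lambda>y. T y $ j) differentiable (at x)" if "x \<in> S" for x j
      using smooth_on_differentiable[OF T that] .
    have df: "f differentiable (at (T x))" if "x \<in> S" for x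
      using Suc.prems V that by auto
    have "Ck_on k S (pd i (\<lambda>x. f (T x)))" for i
    proof (rule Ck_on_cong[OF S])
      have "Ck_on k S (\<lambda>x. \<Sum>j\<in>J. pd j f (T x) * pd i (\<lambda>y. T y $ j) x)" if "finite J" for J
        using that
      proof (induction J)
        case (insert j J)
        have "Ck_on k S (pd i (\<lambda>y. T y $ j))"
          using smooth_on_pd[OF T] by (simp add: smooth_on_def)
        moreover have "Ck_on k S (\<lambda>x. pd j f (T x))"
          using Suc.prems by (intro Suc.IH) auto
        ultimately show ?case using insert S by (simp add: Ck_on_add Ck_on_mult)
      qed (simp add: Ck_on_const)
      then show "Ck_on k S (\<lambda>x. \<Sum>j\<in>UNIV. pd j f (T x) * pd i (\<lambda>y. T y $ j) x)" by simp
    qed (use dT df in \<open>simp add: pd_compose\<close>)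
    then show ?case using dT df by (auto intro: pd_compose)
  qed
  then show ?thesis using f by (simp add: smooth_on_def)
qed

lemma smooth_on_det:
  fixes M :: "real^'n::finite \<Rightarrow> real^'m::finite^'m"
  assumes "open S" "\<And>i j. smooth_on S (\<lambda>x. M x $ i $ j)"
  shows "smooth_on S (\<lambda>x. det (M x))"
  unfolding det_def using assms
  by (intro smooth_on_sum smooth_on_mult smooth_on_const smooth_on_prod) auto

lemma matrix_inv_mult:
  assumes "invertible M"
  shows "matrix_inv M ** M = mat 1" "M ** matrix_inv M = mat 1"
  using someI_ex[OF assms[unfolded invertible_def]] by (simp_all add: matrix_inv_def)

text \<open>Cramer's rule exhibits the entries of the inverse as rational functions of the entries of the
  matrix, so they inherit smoothness from the latter.\<close>

lemma matrix_inv_cramer: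
  fixes M :: "real^'n::finite^'n"
  assumes "invertible M"
  shows "matrix_inv M $ k $ l =
    det (\<chi> i j. if j = k then axis l 1 $ i else M $ i $ j) * inverse (det M)"
proof -
  have "M *v (matrix_inv M *v axis l 1) = axis l 1"
    by (simp add: matrix_vector_mul_assoc matrix_inv_mult[OF assms])
  then have "(matrix_inv M *v axis l 1) $ k =
      det (\<chi> i j. if j = k then axis l 1 $ i else M $ i $ j) / det M"
    using cramer[of M "matrix_inv M *v axis l 1" "axis l 1"] assms
    by (simp add: invertible_det_nz)
  then show ?thesis
    by (simp add: matrix_vector_mul_component inner_axis divide_inverse)
qed

lemma smooth_on_matrix_inv:
  fixes M :: "real^'n::finite \<Rightarrow> real^'m::finite^'m"
  assumes S: "open S" and M: "\<And>i j. smooth_on S (\<lambda>x. M x $ i $ j)"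
    and inv: "\<And>x. x \<in> S \<Longrightarrow> invertible (M x)"
  shows "smooth_on S (\<lambda>x. matrix_inv (M x) $ k $ l)"
proof (rule smooth_on_cong[OF S matrix_inv_cramer[symmetric, OF inv]])
  have "smooth_on S (\<lambda>x. if j = k then axis l 1 $ i else M x $ i $ j)" for i j
    using M by (cases "j = k") (auto intro: smooth_on_const)
  then show "smooth_on S (\<lambda>x. det (\<chi> i j. if j = k then axis l 1 $ i else M x $ i $ j) *
      inverse (det (M x)))"
    using S M inv
    by (intro smooth_on_mult smooth_on_inverse smooth_on_det) (auto simp: invertible_det_nz)
qed

section \<open>Symmetry of second derivatives\<close>

lemma DERIV_pd_line:
  assumes "f differentiable (at (y + s *\<^sub>R axis i 1))"
  shows "((\<lambda>s. f (y + s *\<^sub>R axis i 1)) has_real_derivative pd i f (y + s *\<^sub>R axis i 1)) (at s)"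
proof -
  have "((\<lambda>s. y + s *\<^sub>R axis i 1) has_derivative (\<lambda>h. h *\<^sub>R axis i 1)) (at s)"
    by (auto intro!: derivative_eq_intros)
  from has_derivative_compose[OF this has_derivative_pd[OF assms]]
  have "((\<lambda>s. f (y + s *\<^sub>R axis i 1)) has_derivative
      (\<lambda>h. \<Sum>j\<in>UNIV. (h *\<^sub>R axis i 1) $ j * pd j f (y + s *\<^sub>R axis i 1))) (at s)" .
  moreover have "(\<lambda>h. \<Sum>j\<in>UNIV. (h *\<^sub>R axis i 1) $ j * pd j f (y + s *\<^sub>R axis i 1)) =
      (*) (pd i f (y + s *\<^sub>R axis i 1))"
    by (rule ext) (simp add: axis_def if_distrib if_distribR sum.delta mult.commute cong: if_cong)
  ultimately show ?thesis by (simp add: has_field_derivative_def)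
qed

text \<open>Two applications of the mean value theorem, first along \<open>i\<close> and then along \<open>j\<close>. The left-hand
  side is symmetric in \<open>i\<close> and \<open>j\<close>, the right-hand side is a mixed derivative at a point
  near \<open>x\<close>: letting \<open>h\<close> tend to 0 gives the symmetry of second derivatives.\<close>

lemma second_difference:
  fixes f :: "real^'n::finite \<Rightarrow> real"
  assumes f: "smooth_on S f" and h: "0 < h" and ball: "cball x (2 * h) \<subseteq> S"
  shows "\<exists>p\<in>cball x (2 * h).
    f (x + h *\<^sub>R axis i 1 + h *\<^sub>R axis j 1) - f (x + h *\<^sub>R axis i 1)
      - f (x + h *\<^sub>R axis j 1) + f x = h * (h * pd j (pd i f) p)"
proof -
  define e :: "real^'n" where "e = axis i 1"
  define u :: "real^'n" where "u = axis j 1"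
  have near: "x + s *\<^sub>R e + t *\<^sub>R u \<in> cball x (2 * h)" if "0 \<le> s" "s \<le> h" "0 \<le> t" "t \<le> h" for s t
  proof -
    have "norm (s *\<^sub>R e + t *\<^sub>R u) \<le> norm (s *\<^sub>R e) + norm (t *\<^sub>R u)"
      by (rule norm_triangle_ineq)
    also have "\<dots> \<le> 2 * h" using that by (simp add: e_def u_def)
    finally show ?thesis
      by (simp add: dist_norm add.assoc)
         (metis norm_minus_cancel minus_add_distrib diff_conv_add_uminus add.commute)
  qed
  have df: "f differentiable (at y)" if "y \<in> cball x (2 * h)" for y
    using smooth_on_differentiable[OF f] that ball by blast
  have ddf: "pd i f differentiable (at y)" if "y \<in> cball x (2 * h)" for y
    using smooth_on_differentiable[OF smooth_on_pd[OF f]] that ball by blast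
  have "((\<lambda>s. f (x + h *\<^sub>R u + s *\<^sub>R e) - f (x + s *\<^sub>R e)) has_real_derivative
      pd i f (x + h *\<^sub>R u + s *\<^sub>R e) - pd i f (x + s *\<^sub>R e)) (at s)" if "0 \<le> s" "s \<le> h" for s
    unfolding e_def
    by (intro derivative_intros DERIV_pd_line df)
       (use near[of s h] near[of s 0] that h in \<open>simp_all add: e_def add_ac\<close>)
  from MVT2[of 0 h, OF h this] obtain s where s: "0 < s" "s < h" and
    1: "f (x + h *\<^sub>R u + h *\<^sub>R e) - f (x + h *\<^sub>R e) - (f (x + h *\<^sub>R u) - f x) =
       h * (pd i f (x + h *\<^sub>R u + s *\<^sub>R e) - pd i f (x + s *\<^sub>R e))"
    by auto
  have "((\<lambda>t. pd i f (x + s *\<^sub>R e + t *\<^sub>R u)) has_real_derivative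
      pd j (pd i f) (x + s *\<^sub>R e + t *\<^sub>R u)) (at t)" if "0 \<le> t" "t \<le> h" for t
    unfolding u_def
    by (intro DERIV_pd_line ddf) (use near[of s t] that s in \<open>simp add: u_def\<close>)
  from MVT2[of 0 h, OF h this] obtain t where t: "0 < t" "t < h" and
    2: "pd i f (x + s *\<^sub>R e + h *\<^sub>R u) - pd i f (x + s *\<^sub>R e) =
       h * pd j (pd i f) (x + s *\<^sub>R e + t *\<^sub>R u)"
    by auto
  show ?thesis
  proof (rule bexI[OF _ near[of s t]])
    show "f (x + h *\<^sub>R axis i 1 + h *\<^sub>R axis j 1) - f (x + h *\<^sub>R axis i 1)
      - f (x + h *\<^sub>R axis j 1) + f x = h * (h * pd j (pd i f) (x + s *\<^sub>R e + t *\<^sub>R u))"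
      using 1 unfolding 2[symmetric] by (simp add: e_def u_def add_ac)
  qed (use s t in auto)
qed

lemma pd_commute:
  fixes f :: "real^'n::finite \<Rightarrow> real"
  assumes S: "open S" "x \<in> S" and f: "smooth_on S f"
  shows "pd i (pd j f) x = pd j (pd i f) x"
proof (rule ccontr)
  assume ne: "pd i (pd j f) x \<noteq> pd j (pd i f) x"
  define \<epsilon> where "\<epsilon> = \<bar>pd i (pd j f) x - pd j (pd i f) x\<bar> / 2"
  have \<epsilon>: "\<epsilon> > 0" using ne by (simp add: \<epsilon>_def)
  have cont: "continuous (at x) (pd a (pd b f))" for a b
    using smooth_on_continuous_on[OF smooth_on_pd[OF smooth_on_pd[OF f]]] S
    by (simp add: continuous_on_eq_continuous_at)
  obtain d1 where d1: "d1 > 0" "\<And>y. dist y x < d1 \<Longrightarrow> dist (pd i (pd j f) y) (pd i (pd j f) x) < \<epsilon>"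
    using cont[of i j] \<epsilon> unfolding continuous_at_eps_delta by meson
  obtain d2 where d2: "d2 > 0" "\<And>y. dist y x < d2 \<Longrightarrow> dist (pd j (pd i f) y) (pd j (pd i f) x) < \<epsilon>"
    using cont[of j i] \<epsilon> unfolding continuous_at_eps_delta by meson
  obtain r where r: "r > 0" "cball x r \<subseteq> S" using S open_contains_cball by blast
  \<comment> \<open>The points of \<open>second_difference\<close> lie within \<open>2 * h\<close> of \<open>x\<close>, which has to be less than \<open>d1\<close>, \<open>d2\<close>.\<close>
  define h where "h = min r (min d1 d2) / 3"
  have h: "h > 0" "2 * h < d1" "2 * h < d2" "2 * h \<le> r" using r d1(1) d2(1) by (auto simp: h_def)
  have sub: "cball x (2 * h) \<subseteq> S" using r(2) h(4) by (meson order_trans subset_cball)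
  obtain p where p: "p \<in> cball x (2 * h)" "f (x + h *\<^sub>R axis i 1 + h *\<^sub>R axis j 1) - f (x
      + h *\<^sub>R axis i 1)
      - f (x + h *\<^sub>R axis j 1) + f x = h * (h * pd j (pd i f) p)"
    using second_difference[OF f h(1) sub] by blast
  obtain q where q: "q \<in> cball x (2 * h)" "f (x + h *\<^sub>R axis j 1 + h *\<^sub>R axis i 1) - f (x
      + h *\<^sub>R axis j 1)
      - f (x + h *\<^sub>R axis i 1) + f x = h * (h * pd i (pd j f) q)"
    using second_difference[OF f h(1) sub] by blast
  have "h * (h * pd j (pd i f) p) = h * (h * pd i (pd j f) q)"
    unfolding p(2)[symmetric] q(2)[symmetric] by (simp add: add_ac)
  then have eq: "pd j (pd i f) p = pd i (pd j f) q" using h(1) by simp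
  have "dist (pd j (pd i f) p) (pd j (pd i f) x) < \<epsilon>" "dist (pd i (pd j f) q) (pd i (pd j f) x) < \<epsilon>"
    using p(1) q(1) h by (auto intro!: d1(2) d2(2) simp: dist_commute)
  then show False unfolding eq \<epsilon>_def dist_real_def by (auto simp: abs_if split: if_splits)
qed

section \<open>Bump functions\<close>

text \<open>The case \<open>k = 0\<close> is the classical function that is flat at 0. Division by powers of \<open>t\<close> makes the
  family closed under differentiation up to linear combinations, so that an induction over all
  \<open>k\<close> simultaneously proves smoothness.\<close>

definition exp_flat :: "nat \<Rightarrow> real \<Rightarrow> real" where
  "exp_flat k t = (if t > 0 then exp (- (1 / t)) / t ^ k else 0)"

lemma exp_flat_tendsto_0: "(exp_flat k \<longlongrightarrow> 0) (at 0)"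
proof (rule filterlim_split_at)
  show "(exp_flat k \<longlongrightarrow> 0) (at_left 0)"
    by (rule tendsto_eventually) (auto simp: exp_flat_def eventually_at_filter)
  have "((\<lambda>t. inverse t ^ k / exp (inverse t)) \<longlongrightarrow> 0) (at_right (0::real))"
    by (rule filterlim_compose[OF tendsto_power_div_exp_0 filterlim_inverse_at_top_right])
  moreover have "\<forall>\<^sub>F t in at_right 0. inverse t ^ k / exp (inverse t) = exp_flat k t"
    by (auto simp: exp_flat_def eventually_at_filter exp_minus field_simps)
  ultimately show "(exp_flat k \<longlongrightarrow> 0) (at_right 0)"
    by (rule Lim_transform_eventually)
qed

text \<open>At \<open>t = 0\<close> the difference quotient of the \<open>k\<close>-th function is the function with index \<open>k + 1\<close>, which
  tends to 0; this makes the formula uniform in \<open>t\<close>.\<close>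

lemma DERIV_exp_flat:
  "(exp_flat k has_real_derivative exp_flat (k + 2) t - real k * exp_flat (k + 1) t) (at t)"
proof -
  consider "t > 0" | "t < 0" | "t = 0" by linarith
  then show ?thesis
  proof cases
    case 1
    have "((\<lambda>t. exp (- (1 / t)) / t ^ k) has_real_derivative
        exp (- (1 / t)) / t ^ (k + 2) - real k * (exp (- (1 / t)) / t ^ (k + 1))) (at t)"
    proof (cases k)
      case 0
      show ?thesis unfolding 0 using 1 by (auto intro!: derivative_eq_intros simp: power2_eq_square)
    next
      case (Suc m)
      show ?thesis unfolding Suc using 1
        by (auto intro!: derivative_eq_intros simp: divide_simps) (cases m; simp add: algebra_simps)
    qed
    then show ?thesis
      using 1 by (auto simp: exp_flat_def intro: has_field_derivative_transform_within_open[of _ _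
          t "{0<..}"])
  next
    case 2
    have "((\<lambda>t. 0) has_real_derivative 0) (at t)" by simp
    then have "(exp_flat k has_real_derivative 0) (at t)"
      by (rule has_field_derivative_transform_within_open[of _ _ t "{..<0}"])
         (use 2 in \<open>auto simp: exp_flat_def\<close>)
    then show ?thesis using 2 by (simp add: exp_flat_def)
  next
    case 3
    have "exp_flat k h / h = exp_flat (k + 1) h" for h by (simp add: exp_flat_def)
    then show ?thesis
      using exp_flat_tendsto_0[of "k + 1"] by (simp add: 3 DERIV_def exp_flat_def[of _ 0])
  qed
qed

lemma smooth_on_exp_flat:
  fixes q :: "real^'n::finite \<Rightarrow> real"
  assumes S: "open S" and q: "smooth_on S q"
  shows "smooth_on S (\<lambda>x. exp_flat k (q x))"
proof -
  have D: "((\<lambda>y. exp_flat k (q y)) has_derivative (\<lambda>h. (\<Sum>j\<in>UNIV. h $ j * pd j q x) *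
      (exp_flat (k + 2) (q x) - real k * exp_flat (k + 1) (q x)))) (at x)" if "x \<in> S" for x k
    using DERIV_compose_FDERIV[OF DERIV_exp_flat has_derivative_pd[OF smooth_on_differentiable[OF
        q that]]] .
  have dif: "(\<lambda>y. exp_flat k (q y)) differentiable (at x)" if "x \<in> S" for x k
    using D[OF that] by (auto simp: differentiable_def)
  have "Ck_on n S (\<lambda>x. exp_flat k (q x))" for n
  proof (induction n arbitrary: k)
    case 0
    show ?case
      using dif by (auto intro!: continuous_at_imp_continuous_on differentiable_imp_continuous_within)
  next
    case (Suc n)
    have "Ck_on n S (pd i (\<lambda>x. exp_flat k (q x)))" for i
    proof (rule Ck_on_cong[OF S])
      have "Ck_on n S (pd i q)" using smooth_on_pd[OF q] by (simp add: smooth_on_def)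
      then show "Ck_on n S (\<lambda>x. pd i q x *
          (exp_flat (k + 2) (q x) + (- real k) * exp_flat (k + 1) (q x)))"
        using S by (intro Ck_on_mult Ck_on_add Ck_on_const Suc.IH) auto
    qed (simp add: pd_eqI[OF D] axis_def if_distrib if_distribR sum.delta cong: if_cong)
    then show ?case using dif by simp
  qed
  then show ?thesis by (simp add: smooth_on_def)
qed

lemma smooth_bump_exists:
  fixes a :: "real^'n::finite"
  assumes "r > 0"
  obtains \<phi> where "\<And>S. open S \<Longrightarrow> smooth_on S \<phi>" "\<phi> a \<noteq> 0" "\<And>x. x \<notin> cball a r \<Longrightarrow> \<phi> x = (0::real)"
proof
  define q where "q x = r * r - (\<Sum>i\<in>UNIV. (x $ i - a $ i) * (x $ i - a $ i))" for x
  have norm: "q x = r * r - norm (x - a) * norm (x - a)" for x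
    by (simp add: q_def norm_vec_def L2_set_def power2_eq_square sum_nonneg)
  have "smooth_on S q" if "open S" for S
    unfolding q_def using that
    by (intro smooth_on_diff smooth_on_const smooth_on_sum smooth_on_mult smooth_on_component)
  then show "smooth_on S (\<lambda>x. exp_flat 0 (q x))" if "open S" for S
    using that smooth_on_exp_flat by blast
  show "exp_flat 0 (q a) \<noteq> 0" using assms by (simp add: norm exp_flat_def)
  show "exp_flat 0 (q x) = 0" if "x \<notin> cball a r" for x
  proof -
    have "r * r \<le> norm (x - a) * norm (x - a)"
      using that assms by (intro mult_mono) (auto simp: dist_norm norm_minus_commute)
    then show ?thesis by (simp add: norm exp_flat_def)
  qed
qed

section \<open>Derivatives of vector- and matrix-valued functions\<close>

lemma matrix_mult_distribs:
  fixes A B :: "real^'n::finite^'m::finite" and C D :: "real^'k::finite^'n"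
  shows "(A + B) ** C = A ** C + B ** C" "(A - B) ** C = A ** C - B ** C"
    "A ** (C + D) = A ** C + A ** D" "A ** (C - D) = A ** C - A ** D"
    "(- A) ** C = - (A ** C)" "A ** (- C) = - (A ** C)"
  by (simp_all add: matrix_matrix_mult_def vec_eq_iff algebra_simps sum.distrib sum_subtractf
      sum_negf)

lemma transpose_linear:
  fixes A B :: "real^'n::finite^'m::finite"
  shows "transpose (A + B) = transpose A + transpose B"
    "transpose (A - B) = transpose A - transpose B"
  by (simp_all add: transpose_def vec_eq_iff)

definition mpd :: "'n::finite \<Rightarrow> (real^'n \<Rightarrow> real^'n^'n) \<Rightarrow> real^'n \<Rightarrow> real^'n^'n" where
  "mpd i M x = (\<chi> a b. pd i (\<lambda>y. M y $ a $ b) x)"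

definition vpd :: "'n::finite \<Rightarrow> (real^'n \<Rightarrow> real^'n) \<Rightarrow> real^'n \<Rightarrow> real^'n" where
  "vpd i w x = (\<chi> a. pd i (\<lambda>y. w y $ a) x)"

definition msmooth :: "(real^'n::finite) set \<Rightarrow> (real^'n \<Rightarrow> real^'n^'n) \<Rightarrow> bool" where
  "msmooth U M \<longleftrightarrow> (\<forall>a b. smooth_on U (\<lambda>x. M x $ a $ b))"

lemma msmoothD: "msmooth U M \<Longrightarrow> smooth_on U (\<lambda>x. M x $ a $ b)"
  by (simp add: msmooth_def)

lemma msmooth_differentiable: "msmooth U M \<Longrightarrow> x \<in> U \<Longrightarrow> (\<lambda>y. M y $ a $ b) differentiable (at x)"
  using msmoothD smooth_on_differentiable by blast

lemma msmooth_mpd: "msmooth U M \<Longrightarrow> msmooth U (mpd i M)"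
  by (auto simp: msmooth_def mpd_def intro: smooth_on_pd)

lemma msmooth_add: "open U \<Longrightarrow> msmooth U M \<Longrightarrow> msmooth U N \<Longrightarrow> msmooth U (\<lambda>x. M x + N x)"
  by (auto simp: msmooth_def intro: smooth_on_add)

lemma msmooth_diff: "open U \<Longrightarrow> msmooth U M \<Longrightarrow> msmooth U N \<Longrightarrow> msmooth U (\<lambda>x. M x - N x)"
  by (auto simp: msmooth_def intro: smooth_on_diff)

lemma msmooth_mult: "open U \<Longrightarrow> msmooth U M \<Longrightarrow> msmooth U N \<Longrightarrow> msmooth U (\<lambda>x. M x ** N x)"
  by (auto simp: msmooth_def matrix_matrix_mult_def intro!: smooth_on_sum smooth_on_mult)

lemma msmooth_transpose: "msmooth U M \<Longrightarrow> msmooth U (\<lambda>x. transpose (M x))"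
  by (auto simp: msmooth_def transpose_def)

lemmas msmooth_intros = msmooth_mpd msmooth_add msmooth_diff msmooth_mult msmooth_transpose

lemma mpd_cong: "open U \<Longrightarrow> x \<in> U \<Longrightarrow> (\<And>y. y \<in> U \<Longrightarrow> M y = N y) \<Longrightarrow> mpd i M x = mpd i N x"
  unfolding mpd_def vec_eq_iff by (auto intro: pd_cong_open)

lemma mpd_add:
  "msmooth U M \<Longrightarrow> msmooth U N \<Longrightarrow> x \<in> U \<Longrightarrow> mpd i (\<lambda>y. M y + N y) x = mpd i M x + mpd i N x"
  by (simp add: mpd_def vec_eq_iff pd_add msmooth_differentiable)

lemma mpd_diff:
  "msmooth U M \<Longrightarrow> msmooth U N \<Longrightarrow> x \<in> U \<Longrightarrow> mpd i (\<lambda>y. M y - N y) x = mpd i M x - mpd i N x"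
  by (simp add: mpd_def vec_eq_iff pd_diff msmooth_differentiable)

lemma mpd_mult:
  "msmooth U M \<Longrightarrow> msmooth U N \<Longrightarrow> x \<in> U \<Longrightarrow>
    mpd i (\<lambda>y. M y ** N y) x = mpd i M x ** N x + M x ** mpd i N x"
  by (simp add: mpd_def vec_eq_iff matrix_matrix_mult_def pd_sum pd_mult
      msmooth_differentiable differentiable_mult sum.distrib)

lemma mpd_transpose: "mpd i (\<lambda>y. transpose (M y)) x = transpose (mpd i M x)"
  by (simp add: mpd_def transpose_def)

lemma mpd_commute: "open U \<Longrightarrow> msmooth U M \<Longrightarrow> x \<in> U \<Longrightarrow> mpd i (mpd j M) x = mpd j (mpd i M) x"
  by (simp add: mpd_def vec_eq_iff pd_commute[where S = U] msmoothD)

lemma vpd_diff_mult: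
  assumes "msmooth U M" "\<And>a. smooth_on U (\<lambda>y. w y $ a)" "x \<in> U"
  shows "vpd i (\<lambda>y. c - M y *v w y) x = - (mpd i M x *v w x) - M x *v vpd i w x"
proof -
  have "(\<lambda>y. M y $ a $ b) differentiable (at x)" "(\<lambda>y. w y $ b) differentiable (at x)" for a b
    using msmooth_differentiable[OF assms(1,3)] smooth_on_differentiable[OF assms(2,3)] by auto
  moreover from this have "(\<lambda>y. M y $ a $ b * w y $ b) differentiable (at x)" for a b
    by (intro differentiable_mult)
  moreover from this have "(\<lambda>y. \<Sum>b\<in>UNIV. M y $ a $ b * w y $ b) differentiable (at x)" for a
    by (intro differentiable_sum) auto
  ultimately show ?thesis
    by (simp add: vpd_def mpd_def vec_eq_iff matrix_vector_mult_def pd_sum pd_mult pd_diff sum.distrib)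
qed

section \<open>Curvature of a metric with a concurrent field\<close>

text \<open>A metric \<open>G\<close> and a vector field \<open>v\<close> on a coordinate domain with \<open>\<nabla>\<^sub>X v = X\<close>. Tensors are
  treated as matrix-valued functions, which turns the classical index computations into matrix
  algebra.\<close>

locale concurrent_patch =
  fixes U :: "(real^'n::finite) set" and G :: "real^'n \<Rightarrow> real^'n^'n" and v :: "real^'n \<Rightarrow> real^'n"
  assumes open_U: "open U"
    and G_smooth: "\<And>i j. smooth_on U (\<lambda>x. G x $ i $ j)"
    and v_smooth: "\<And>i. smooth_on U (\<lambda>x. v x $ i)"
    and G_sym: "\<And>x. x \<in> U \<Longrightarrow> transpose (G x) = G x"
    and G_inv: "\<And>x. x \<in> U \<Longrightarrow> invertible (G x)"
    and concurrent: "\<And>x i k. x \<in> U \<Longrightarrow>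
      pd i (\<lambda>y. v y $ k) x + (\<Sum>j\<in>UNIV. christoffel G k i j x * v x $ j) = (if i = k then 1 else 0)"
begin

text \<open>The connection matrices: the covariant derivative along the \<open>i\<close>-th coordinate field is the
  partial derivative plus \<open>\<Gamma> i\<close>.\<close>

definition \<Gamma> :: "'n \<Rightarrow> real^'n \<Rightarrow> real^'n^'n" where
  "\<Gamma> i x = (\<chi> k j. christoffel G k i j x)"

text \<open>The curvature as the commutator of the covariant derivatives along the \<open>i\<close>-th and \<open>j\<close>-th
  coordinate fields, that is, the endomorphism \<open>R(e\<^sub>i, e\<^sub>j)\<close>.\<close>

definition F :: "'n \<Rightarrow> 'n \<Rightarrow> real^'n \<Rightarrow> real^'n^'n" where
  "F i j x = mpd i (\<Gamma> j) x - mpd j (\<Gamma> i) x + \<Gamma> i x ** \<Gamma> j x - \<Gamma> j x ** \<Gamma> i x"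

text \<open>The connection matrix in the direction of \<open>v\<close>: the covariant derivative along \<open>v\<close> is \<open>dv\<close> plus \<open>W\<close>.\<close>

definition W :: "real^'n \<Rightarrow> real^'n^'n" where
  "W x = (\<Sum>i\<in>UNIV. v x $ i *\<^sub>R \<Gamma> i x)"

definition dv :: "(real^'n \<Rightarrow> real) \<Rightarrow> real^'n \<Rightarrow> real" where
  "dv f x = (\<Sum>i\<in>UNIV. v x $ i * pd i f x)"

lemma riemann_F: "riemann G l k i j x = F i j x $ l $ k"
  by (simp add: riemann_def F_def mpd_def \<Gamma>_def matrix_matrix_mult_def sum_subtractf eta_contract_eq)

lemma ricci_F: "ricci G j k x = (\<Sum>i\<in>UNIV. F i j x $ i $ k)"
  by (simp add: ricci_def riemann_F)

lemma msmooth_G: "msmooth U G"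
  by (simp add: msmooth_def G_smooth)

lemma msmooth_inv: "msmooth U (\<lambda>x. matrix_inv (G x))"
  using smooth_on_matrix_inv[OF open_U G_smooth G_inv] by (simp add: msmooth_def)

lemma msmooth_\<Gamma>: "msmooth U (\<Gamma> i)"
  unfolding msmooth_def \<Gamma>_def christoffel_def vec_lambda_beta
  using open_U G_smooth smooth_on_matrix_inv[OF open_U G_smooth G_inv]
  by (intro allI smooth_on_mult smooth_on_const smooth_on_sum smooth_on_add smooth_on_diff smooth_on_pd)

lemma msmooth_F: "msmooth U (F i j)"
  unfolding F_def by (intro msmooth_intros msmooth_\<Gamma> open_U)

lemma levi_civita:
  assumes "x \<in> U"
  shows \<Gamma>_sym: "\<Gamma> i x $ k $ j = \<Gamma> j x $ k $ i"
    and mpd_G: "mpd k G x = transpose (\<Gamma> k x) ** G x + G x ** \<Gamma> k x"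
proof -
  have "(\<forall>k i j. christoffel G k i j x = christoffel G k j i x) \<and>
         (\<forall>k i j. pd k (\<lambda>y. G y $ i $ j) x =
            (\<Sum>l\<in>UNIV. christoffel G l k i x * G x $ l $ j)
                + (\<Sum>l\<in>UNIV. christoffel G l k j x * G x $ i $ l))"
    using christoffel_levi_civita[where S = U and G = G and x = x
        and C = "\<lambda>k i j. christoffel G k i j x"] open_U assms G_sym G_inv by blast
  then show "\<Gamma> i x $ k $ j = \<Gamma> j x $ k $ i"
    "mpd k G x = transpose (\<Gamma> k x) ** G x + G x ** \<Gamma> k x"
    unfolding \<Gamma>_def mpd_def vec_eq_iff
    by (simp_all add: matrix_matrix_mult_def transpose_def mult.commute)
qed

lemma vpd_v: "x \<in> U \<Longrightarrow> vpd i v x = axis i 1 - \<Gamma> i x *v v x"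
  using concurrent[of x i]
  by (auto simp: vec_eq_iff vpd_def \<Gamma>_def matrix_vector_mult_def axis_def algebra_simps)

text \<open>Since the connection is torsion-free, the same matrix \<open>W\<close> also describes the partial derivatives
  of \<open>v\<close>: the concurrency equation reads \<open>\<partial>\<^sub>i v\<^sup>k = \<delta> - W\<close>.\<close>

lemma \<Gamma>_v_eq_W:
  assumes "x \<in> U"
  shows "(\<Gamma> i x *v v x) $ k = W x $ k $ i"
  using \<Gamma>_sym[OF assms, of i k]
  by (simp add: matrix_vector_mult_def W_def sum_component mult.commute)

lemma pd_v: "x \<in> U \<Longrightarrow> pd i (\<lambda>y. v y $ k) x = (if k = i then 1 else 0) - W x $ k $ i"
  using vpd_v[of x i] \<Gamma>_v_eq_W[of x i k]
  by (auto simp: vec_eq_iff vpd_def axis_def)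

lemma F_antisym: "F j i x = - F i j x"
  by (simp add: F_def)

text \<open>For a concurrent field, \<open>R(X, Y) v = \<nabla>\<^sub>X Y - \<nabla>\<^sub>Y X - [X, Y] = 0\<close> by torsion-freeness. In coordinates
  this is the symmetry of the second derivatives of \<open>v\<close>.\<close>

lemma F_v:
  assumes x: "x \<in> U"
  shows "F i j x *v v x = 0"
proof -
  have 1: "vpd i (vpd j v) x = - (mpd i (\<Gamma> j) x *v v x) - \<Gamma> j x *v (axis i 1 - \<Gamma> i x *v v x)" for i j
  proof -
    have "vpd i (vpd j v) x = vpd i (\<lambda>y. axis j 1 - \<Gamma> j y *v v y) x"
      unfolding vpd_def[of i] vec_eq_iff
      by (auto intro!: pd_cong_open[OF open_U x] simp: vpd_v)
    then show ?thesis
      using vpd_diff_mult[OF msmooth_\<Gamma> v_smooth x] vpd_v[OF x] by simp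
  qed
  have "vpd i (vpd j v) x = vpd j (vpd i v) x"
    using pd_commute[OF open_U x v_smooth] by (simp add: vpd_def)
  moreover have "\<Gamma> j x *v axis i 1 = \<Gamma> i x *v axis j 1"
    by (auto simp: vec_eq_iff matrix_vector_mult_basis column_def intro: \<Gamma>_sym[OF x])
  ultimately show ?thesis
    unfolding 1 by (simp add: F_def algebra_simps matrix_vector_mul_assoc)
qed

text \<open>The connection is metric, so commuting the second derivatives of \<open>G\<close> shows that the curvature
  endomorphisms are skew-adjoint.\<close>

lemma F_skew:
  assumes x: "x \<in> U"
  shows "transpose (F i j x) ** G x + G x ** F i j x = 0"
proof -
  have 1: "mpd i (mpd j G) x =
      transpose (mpd i (\<Gamma> j) x) ** G x
      + transpose (\<Gamma> j x) ** (transpose (\<Gamma> i x) ** G x + G x ** \<Gamma> i x)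
      + (transpose (\<Gamma> i x) ** G x + G x ** \<Gamma> i x) ** \<Gamma> j x + G x ** mpd i (\<Gamma> j) x" for i j
  proof -
    have "mpd i (mpd j G) x = mpd i (\<lambda>y. transpose (\<Gamma> j y) ** G y + G y ** \<Gamma> j y) x"
      by (rule mpd_cong[OF open_U x mpd_G])
    also have "\<dots> = mpd i (\<lambda>y. transpose (\<Gamma> j y) ** G y) x + mpd i (\<lambda>y. G y ** \<Gamma> j y) x"
      by (rule mpd_add[where U = U]) (intro msmooth_intros msmooth_\<Gamma> msmooth_G open_U x)+
    finally show ?thesis
      by (simp add: mpd_mult[where U = U] msmooth_\<Gamma> msmooth_G msmooth_transpose x mpd_transpose mpd_G)
  qed
  from mpd_commute[OF open_U msmooth_G x, of i j] show ?thesis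
    unfolding 1 F_def
    by (simp add: matrix_mult_distribs transpose_linear matrix_transpose_mul matrix_mul_assoc
        algebra_simps)
qed

lemma first_bianchi:
  assumes x: "x \<in> U"
  shows "F i j x $ a $ k + F j k x $ a $ i + F k i x $ a $ j = 0"
proof -
  have "mpd i (\<Gamma> j) x $ a $ k = mpd i (\<Gamma> k) x $ a $ j" for i j k
    unfolding mpd_def using \<Gamma>_sym by (auto intro!: pd_cong_open[OF open_U x])
  then show ?thesis
    using \<Gamma>_sym[OF x] by (simp add: F_def matrix_matrix_mult_def)
qed

lemma second_bianchi:
  assumes x: "x \<in> U"
  shows "(mpd i (F j k) x + \<Gamma> i x ** F j k x - F j k x ** \<Gamma> i x)
    + (mpd j (F k i) x + \<Gamma> j x ** F k i x - F k i x ** \<Gamma> j x)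
    + (mpd k (F i j) x + \<Gamma> k x ** F i j x - F i j x ** \<Gamma> k x) = 0"
proof -
  have 1: "mpd i (F j k) x = mpd i (mpd j (\<Gamma> k)) x - mpd i (mpd k (\<Gamma> j)) x
      + (mpd i (\<Gamma> j) x ** \<Gamma> k x + \<Gamma> j x ** mpd i (\<Gamma> k) x)
      - (mpd i (\<Gamma> k) x ** \<Gamma> j x + \<Gamma> k x ** mpd i (\<Gamma> j) x)" for i j k
  proof -
    have "F j k = (\<lambda>y. (mpd j (\<Gamma> k) y - mpd k (\<Gamma> j) y + \<Gamma> j y ** \<Gamma> k y) - \<Gamma> k y ** \<Gamma> j y)"
      by (rule ext) (rule F_def)
    then show ?thesis
      by (simp add: mpd_add[where U = U] mpd_diff[where U = U] mpd_mult[where U = U] msmooth_\<Gamma>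
        msmooth_intros x open_U)
  qed
  note c = mpd_commute[OF open_U msmooth_\<Gamma> x, of i j k] mpd_commute[OF open_U msmooth_\<Gamma> x, of j k i]
      mpd_commute[OF open_U msmooth_\<Gamma> x, of k i j]
  show ?thesis
    unfolding 1 F_def c
    by (simp add: matrix_mult_distribs matrix_mul_assoc)
qed

text \<open>This is \<open>R(v, e\<^sub>j) = 0\<close>. Contracting the first Bianchi identity with \<open>v\<close> and using \<open>R(X, Y) v = 0\<close>
  shows that \<open>g(R(v, e\<^sub>j) e\<^sub>i, e\<^sub>a)\<close> is symmetric in \<open>i\<close> and \<open>j\<close>, whereas it is skew in \<open>i\<close> and \<open>a\<close>. A trilinear
  expression with these two symmetries vanishes.\<close>

lemma v_F:
  assumes x: "x \<in> U"
  shows "(\<Sum>i\<in>UNIV. v x $ i *\<^sub>R F i j x) = 0"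
proof -
  define E where "E j = (\<Sum>l\<in>UNIV. v x $ l *\<^sub>R F l j x)" for j
  define T where "T j = G x ** E j" for j
  have E: "E j $ a $ i = E i $ a $ j" for i j a
  proof -
    have "(\<Sum>l\<in>UNIV. v x $ l * (F i j x $ a $ l + F j l x $ a $ i + F l i x $ a $ j)) = 0"
      by (simp add: first_bianchi[OF x])
    moreover have "(\<Sum>l\<in>UNIV. v x $ l * F i j x $ a $ l) = 0"
      using F_v[OF x, of i j] by (simp add: vec_eq_iff matrix_vector_mult_def mult.commute)
    moreover have "F j l x = - F l j x" for l by (rule F_antisym)
    ultimately show ?thesis
      by (simp add: E_def sum_component distrib_left right_diff_distrib sum.distrib sum_subtractf)
  qed
  have T_sym: "T j $ a $ i = T i $ a $ j" for i j a
    by (simp add: T_def matrix_matrix_mult_def E[of j])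
  have T_skew: "T j $ a $ i = - T j $ i $ a" for i j a
  proof -
    have T: "T j $ a $ i = (\<Sum>l\<in>UNIV. v x $ l * (G x ** F l j x) $ a $ i)" for a i
      unfolding T_def E_def matrix_matrix_mult_def vec_lambda_beta sum_component sum_distrib_left
      by (subst sum.swap) (simp add: mult_ac)
    have "(G x ** F l j x) $ a $ i = - (G x ** F l j x) $ i $ a" for l
    proof -
      have "transpose (G x ** F l j x) = transpose (F l j x) ** G x"
        by (simp add: matrix_transpose_mul G_sym[OF x])
      then have "transpose (G x ** F l j x) + G x ** F l j x = 0"
        using F_skew[OF x] by simp
      then show ?thesis by (simp add: vec_eq_iff transpose_def eq_neg_iff_add_eq_0 add.commute)
    qed
    then show ?thesis by (simp add: T sum_negf)
  qed
  have "T j $ a $ i = 0" for j a i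
    using T_sym[of j a i] T_skew[of j a i] T_sym[of j i a] T_skew[of a i j] T_sym[of a j i]
      T_skew[of i j a] by simp
  then have "T j = 0" by (simp add: vec_eq_iff)
  then have "matrix_inv (G x) ** T j = 0" by (simp add: matrix_matrix_mult_def vec_eq_iff)
  then show ?thesis
    by (simp add: T_def E_def matrix_mul_assoc matrix_inv_mult[OF G_inv[OF x]])
qed

text \<open>The second Bianchi identity contracted with \<open>v\<close>. The derivatives of the curvature in the other
  two directions are transferred to \<open>v\<close> by differentiating \<open>R(v, e\<^sub>k) = 0\<close>; since \<open>\<nabla>v\<close> is the identity,
  each of them returns the curvature itself up to sign. Invariantly, the result is \<open>\<nabla>\<^sub>v R = - 2 R\<close>.\<close>

lemma dv_F:
  assumes x: "x \<in> U"
  shows "dv (\<lambda>y. F j k y $ a $ b) x =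
    - (W x ** F j k x) $ a $ b + (F j k x ** W x) $ a $ b - 2 * F j k x $ a $ b
    + (\<Sum>i\<in>UNIV. W x $ i $ j * F i k x $ a $ b) + (\<Sum>i\<in>UNIV. W x $ i $ k * F j i x $ a $ b)"
proof -
  have vF: "(\<Sum>i\<in>UNIV. v y $ i * F i j y $ a $ b) = 0" if "y \<in> U" for y j a b
    using v_F[OF that, of j] by (simp add: vec_eq_iff sum_component)
  \<comment> \<open>The product rule applied to \<open>vF\<close> moves the derivative from the curvature to \<open>v\<close>.\<close>
  have d: "(\<Sum>i\<in>UNIV. v x $ i * pd j (\<lambda>y. F i k y $ a $ b) x) =
      (\<Sum>i\<in>UNIV. W x $ i $ j * F i k x $ a $ b) - F j k x $ a $ b" for j k a b
  proof -
    have "pd j (\<lambda>y. \<Sum>i\<in>UNIV. v y $ i * F i k y $ a $ b) x = pd j (\<lambda>y. 0) x"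
      by (rule pd_cong_open[OF open_U x]) (rule vF)
    then have "(\<Sum>i\<in>UNIV. pd j (\<lambda>y. v y $ i) x * F i k x $ a $ b
        + v x $ i * pd j (\<lambda>y. F i k y $ a $ b) x) = 0"
      using smooth_on_differentiable[OF v_smooth x] msmooth_differentiable[OF msmooth_F x]
      by (simp add: pd_sum pd_mult differentiable_mult)
    then show ?thesis
      by (simp add: pd_v[OF x] sum.distrib left_diff_distrib sum_subtractf mult_delta_left)
  qed
  have c: "(\<Sum>i\<in>UNIV. v x $ i * (M ** F i k x) $ a $ b) = 0"
    "(\<Sum>i\<in>UNIV. v x $ i * (F i k x ** M) $ a $ b) = 0" for M k
  proof -
    have "(\<Sum>i\<in>UNIV. v x $ i * (M ** F i k x) $ a $ b) =
        (\<Sum>m\<in>UNIV. M $ a $ m * (\<Sum>i\<in>UNIV. v x $ i * F i k x $ m $ b))"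
      unfolding matrix_matrix_mult_def vec_lambda_beta sum_distrib_left
      by (subst sum.swap) (simp add: mult_ac)
    then show "(\<Sum>i\<in>UNIV. v x $ i * (M ** F i k x) $ a $ b) = 0" by (simp add: vF[OF x])
    have "(\<Sum>i\<in>UNIV. v x $ i * (F i k x ** M) $ a $ b) =
        (\<Sum>m\<in>UNIV. M $ m $ b * (\<Sum>i\<in>UNIV. v x $ i * F i k x $ a $ m))"
      unfolding matrix_matrix_mult_def vec_lambda_beta sum_distrib_left
      by (subst sum.swap) (simp add: mult_ac)
    then show "(\<Sum>i\<in>UNIV. v x $ i * (F i k x ** M) $ a $ b) = 0" by (simp add: vF[OF x])
  qed
  have w: "(\<Sum>i\<in>UNIV. v x $ i * (\<Gamma> i x ** M) $ a $ b) = (W x ** M) $ a $ b"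
    "(\<Sum>i\<in>UNIV. v x $ i * (M ** \<Gamma> i x) $ a $ b) = (M ** W x) $ a $ b" for M
    unfolding W_def matrix_matrix_mult_def vec_lambda_beta sum_component sum_distrib_left
    sum_distrib_right
    by (subst sum.swap, simp add: mult_ac)+
  have neg: "pd j (\<lambda>y. F k i y $ a $ b) x = - pd j (\<lambda>y. F i k y $ a $ b) x" for i j k
    using pd_cmult[OF msmooth_differentiable[OF msmooth_F x], of j "-1" i k a b] F_antisym[of k i]
    by simp
  have "0 = (\<Sum>i\<in>UNIV. v x $ i * ((mpd i (F j k) x + \<Gamma> i x ** F j k x - F j k x ** \<Gamma> i x)
    + (mpd j (F k i) x + \<Gamma> j x ** F k i x - F k i x ** \<Gamma> j x)
    + (mpd k (F i j) x + \<Gamma> k x ** F i j x - F i j x ** \<Gamma> k x)) $ a $ b)"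
    by (simp only: second_bianchi[OF x]) simp
  also have "\<dots> = dv (\<lambda>y. F j k y $ a $ b) x + (W x ** F j k x) $ a $ b - (F j k x ** W x) $ a $ b
     - (\<Sum>i\<in>UNIV. v x $ i * pd j (\<lambda>y. F i k y $ a $ b) x)
     + (\<Sum>i\<in>UNIV. v x $ i * pd k (\<lambda>y. F i j y $ a $ b) x)"
    unfolding F_antisym[of k _ x] matrix_mult_distribs
    by (simp add: mpd_def neg[of j k] distrib_left right_diff_distrib sum.distrib sum_subtractf sum_negf
        c w dv_def)
  also have "(\<Sum>i\<in>UNIV. v x $ i * pd k (\<lambda>y. F i j y $ a $ b) x) =
      F j k x $ a $ b - (\<Sum>i\<in>UNIV. W x $ i $ k * F j i x $ a $ b)"
  proof -
    have "F i j x $ a $ b = - (F j i x $ a $ b)" for i using F_antisym[of i j x] by simp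
    then have "(\<Sum>i\<in>UNIV. W x $ i $ k * F i j x $ a $ b) = (\<Sum>i\<in>UNIV. - (W x $ i $ k * F j i x $ a $ b))"
      by (intro sum.cong refl) (metis mult_minus_right)
    then show ?thesis unfolding d[of k j] using F_antisym[of k j x] by (simp add: sum_negf)
  qed
  finally show ?thesis unfolding d by simp
qed

text \<open>The trace of the preceding formula. As \<open>\<partial>v = 1 - W\<close>, it says that the Lie derivative of the Ricci
  tensor along \<open>v\<close> vanishes, as it must for a homothetic field.\<close>

lemma dv_ricci:
  assumes x: "x \<in> U"
  shows "dv (ricci G j k) x = - 2 * ricci G j k x
    + (\<Sum>m\<in>UNIV. ricci G j m x * W x $ m $ k) + (\<Sum>m\<in>UNIV. W x $ m $ j * ricci G m k x)"
proof -
  have "dv (ricci G j k) x = (\<Sum>i\<in>UNIV. dv (\<lambda>y. F i j y $ i $ k) x)"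
  proof -
    have "ricci G j k = (\<lambda>y. \<Sum>i\<in>UNIV. F i j y $ i $ k)" by (rule ext) (rule ricci_F)
    then show ?thesis
      unfolding dv_def by (simp add: pd_sum msmooth_differentiable[OF msmooth_F x] sum_distrib_left)
        (rule sum.swap)
  qed
  moreover have "(\<Sum>i\<in>UNIV. (W x ** F i j x) $ i $ k) =
      (\<Sum>i\<in>UNIV. \<Sum>m\<in>UNIV. W x $ m $ i * F m j x $ i $ k)"
    unfolding matrix_matrix_mult_def vec_lambda_beta by (rule sum.swap)
  moreover have "(\<Sum>i\<in>UNIV. (F i j x ** W x) $ i $ k) = (\<Sum>m\<in>UNIV. ricci G j m x * W x $ m $ k)"
    unfolding matrix_matrix_mult_def vec_lambda_beta ricci_F sum_distrib_right by (rule sum.swap)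
  moreover have "(\<Sum>i\<in>UNIV. \<Sum>m\<in>UNIV. W x $ m $ j * F i m x $ i $ k) =
      (\<Sum>m\<in>UNIV. W x $ m $ j * ricci G m k x)"
    unfolding ricci_F sum_distrib_left by (rule sum.swap)
  ultimately show ?thesis
    by (simp add: dv_F[OF x] sum.distrib sum_subtractf sum_negf ricci_F sum_distrib_left)
qed

text \<open>The inverse metric is parallel; the derivative is obtained from \<open>G\<^sup>-\<^sup>1 G = 1\<close> and metric
  compatibility.\<close>

lemma dv_matrix_inv:
  assumes x: "x \<in> U"
  shows "dv (\<lambda>y. matrix_inv (G y) $ j $ k) x =
    - (\<Sum>m\<in>UNIV. matrix_inv (G x) $ j $ m * W x $ k $ m)
        - (\<Sum>m\<in>UNIV. W x $ j $ m * matrix_inv (G x) $ m $ k)"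
proof -
  define H where "H = matrix_inv (G x)"
  have HG: "H ** G x = mat 1" "G x ** H = mat 1"
    using matrix_inv_mult[OF G_inv[OF x]] by (simp_all add: H_def)
  have 1: "mpd i (\<lambda>y. matrix_inv (G y)) x = - (H ** transpose (\<Gamma> i x)) - \<Gamma> i x ** H" for i
  proof -
    define D where "D = mpd i (\<lambda>y. matrix_inv (G y)) x"
    have "mpd i (\<lambda>y. matrix_inv (G y) ** G y) x = mpd i (\<lambda>y. mat 1) x"
      by (rule mpd_cong[OF open_U x]) (rule matrix_inv_mult[OF G_inv])
    then have "D ** G x + H ** (transpose (\<Gamma> i x) ** G x + G x ** \<Gamma> i x) = 0"
      by (simp add: mpd_mult[where U = U] msmooth_inv msmooth_G x mpd_G D_def H_def)
         (simp add: mpd_def vec_eq_iff)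
    then have "(D ** G x + H ** (transpose (\<Gamma> i x) ** G x + G x ** \<Gamma> i x)) ** H = 0"
      by (simp add: matrix_matrix_mult_def vec_eq_iff)
    then have "D + H ** transpose (\<Gamma> i x) + \<Gamma> i x ** H = 0"
      by (simp add: matrix_mult_distribs matrix_mul_assoc HG add.assoc)
         (simp add: matrix_mul_assoc[symmetric] HG)
    then show ?thesis unfolding D_def by (simp add: eq_neg_iff_add_eq_0 algebra_simps)
  qed
  then have "pd i (\<lambda>y. matrix_inv (G y) $ j $ k) x =
      - (\<Sum>m\<in>UNIV. H $ j $ m * \<Gamma> i x $ k $ m) - (\<Sum>m\<in>UNIV. \<Gamma> i x $ j $ m * H $ m $ k)" for i
    by (simp add: vec_eq_iff mpd_def matrix_matrix_mult_def transpose_def)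
  then have "dv (\<lambda>y. matrix_inv (G y) $ j $ k) x =
      - (\<Sum>i\<in>UNIV. \<Sum>m\<in>UNIV. v x $ i * (H $ j $ m * \<Gamma> i x $ k $ m))
          - (\<Sum>i\<in>UNIV. \<Sum>m\<in>UNIV. v x $ i * (\<Gamma> i x $ j $ m * H $ m $ k))"
    by (simp add: dv_def right_diff_distrib sum_subtractf sum_negf sum_distrib_left)
  moreover have "(\<Sum>i\<in>UNIV. \<Sum>m\<in>UNIV. v x $ i * (H $ j $ m * \<Gamma> i x $ k $ m)) =
      (\<Sum>m\<in>UNIV. H $ j $ m * W x $ k $ m)"
    by (subst sum.swap) (simp add: W_def sum_component sum_distrib_left mult_ac)
  moreover have "(\<Sum>i\<in>UNIV. \<Sum>m\<in>UNIV. v x $ i * (\<Gamma> i x $ j $ m * H $ m $ k)) =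
      (\<Sum>m\<in>UNIV. W x $ j $ m * H $ m $ k)"
    by (subst sum.swap) (simp add: W_def sum_component sum_distrib_left sum_distrib_right mult_ac)
  ultimately show ?thesis by (simp add: H_def)
qed

definition scal :: "real^'n \<Rightarrow> real" where
  "scal x = (\<Sum>j\<in>UNIV. \<Sum>k\<in>UNIV. matrix_inv (G x) $ j $ k * ricci G j k x)"

text \<open>Contracting the Ricci tensor with the inverse metric, all terms containing \<open>W\<close> cancel in pairs
  after renaming summation indices, because the scalar curvature is invariantly defined. What
  remains is the scaling of the curvature under the homothetic field \<open>v\<close>.\<close>

lemma dv_scal:
  assumes x: "x \<in> U"
  shows "dv scal x = - 2 * scal x"
proof -
  define H where "H = matrix_inv (G x)"
  define R where "R j k = ricci G j k x" for j k
  define w where "w = W x"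
  have dR: "ricci G j k differentiable (at x)" for j k
  proof -
    have "(\<lambda>y. \<Sum>i\<in>UNIV. F i j y $ i $ k) differentiable (at x)"
      using msmooth_differentiable[OF msmooth_F x] by (intro differentiable_sum) auto
    then show ?thesis by (simp add: ricci_F[abs_def])
  qed
  have dH: "(\<lambda>y. matrix_inv (G y) $ j $ k) differentiable (at x)" for j k
    by (rule msmooth_differentiable[OF msmooth_inv x])
  have d2: "(\<lambda>y. matrix_inv (G y) $ j $ k * ricci G j k y) differentiable (at x)" for j k
    by (intro differentiable_mult dR dH)
  have "dv scal x = (\<Sum>i\<in>UNIV. \<Sum>j\<in>UNIV. \<Sum>k\<in>UNIV. v x $ i *
      (pd i (\<lambda>y. matrix_inv (G y) $ j $ k) x * R j k + H $ j $ k * pd i (ricci G j k) x))"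
    using d2 differentiable_sum[of UNIV "\<lambda>k y. matrix_inv (G y) $ j $ k * ricci G j k y" "at x" for j]
    by (simp add: dv_def scal_def[abs_def] pd_sum pd_mult dR dH R_def H_def sum_distrib_left)
  also have "\<dots> = (\<Sum>j\<in>UNIV. \<Sum>k\<in>UNIV. \<Sum>i\<in>UNIV. v x $ i *
      (pd i (\<lambda>y. matrix_inv (G y) $ j $ k) x * R j k + H $ j $ k * pd i (ricci G j k) x))"
    by (subst sum.swap) (intro sum.cong refl sum.swap)
  also have "\<dots> = (\<Sum>j\<in>UNIV. \<Sum>k\<in>UNIV. dv (\<lambda>y. matrix_inv (G y) $ j $ k) x * R j k
      + H $ j $ k * dv (ricci G j k) x)"
    by (simp add: dv_def distrib_left sum.distrib sum_distrib_left sum_distrib_right mult_ac)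
  also have "\<dots> = (\<Sum>j\<in>UNIV. \<Sum>k\<in>UNIV. - (\<Sum>m\<in>UNIV. H $ j $ m * w $ k $ m * R j k)
      - (\<Sum>m\<in>UNIV. w $ j $ m * H $ m $ k * R j k) - 2 * (H $ j $ k * R j k)
      + (\<Sum>m\<in>UNIV. H $ j $ k * R j m * w $ m $ k) + (\<Sum>m\<in>UNIV. H $ j $ k * w $ m $ j * R m k))"
    unfolding dv_matrix_inv[OF x] dv_ricci[OF x]
    by (simp add: R_def H_def w_def algebra_simps sum_distrib_left sum_distrib_right)
  also have "\<dots> = - (\<Sum>j\<in>UNIV. \<Sum>k\<in>UNIV. \<Sum>m\<in>UNIV. H $ j $ m * w $ k $ m * R j k)
      - (\<Sum>j\<in>UNIV. \<Sum>k\<in>UNIV. \<Sum>m\<in>UNIV. w $ j $ m * H $ m $ k * R j k)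
          - 2 * (\<Sum>j\<in>UNIV. \<Sum>k\<in>UNIV. H $ j $ k * R j k)
      + (\<Sum>j\<in>UNIV. \<Sum>k\<in>UNIV. \<Sum>m\<in>UNIV. H $ j $ k * R j m * w $ m $ k)
          + (\<Sum>j\<in>UNIV. \<Sum>k\<in>UNIV. \<Sum>m\<in>UNIV. H $ j $ k * w $ m $ j * R m k)"
    by (simp add: sum.distrib sum_subtractf sum_negf sum_distrib_left)
  also have "(\<Sum>j\<in>UNIV. \<Sum>k\<in>UNIV. \<Sum>m\<in>UNIV. H $ j $ k * R j m * w $ m $ k) =
      (\<Sum>j\<in>UNIV. \<Sum>k\<in>UNIV. \<Sum>m\<in>UNIV. H $ j $ m * w $ k $ m * R j k)"
    by (rule sum.cong[OF refl], subst sum.swap) (simp add: mult_ac)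
  also have "(\<Sum>j\<in>UNIV. \<Sum>k\<in>UNIV. \<Sum>m\<in>UNIV. H $ j $ k * w $ m $ j * R m k) =
      (\<Sum>j\<in>UNIV. \<Sum>m\<in>UNIV. \<Sum>k\<in>UNIV. H $ j $ k * w $ m $ j * R m k)"
    by (intro sum.cong refl sum.swap)
  also have "\<dots> = (\<Sum>m\<in>UNIV. \<Sum>j\<in>UNIV. \<Sum>k\<in>UNIV. H $ j $ k * w $ m $ j * R m k)"
    by (rule sum.swap)
  also have "\<dots> = (\<Sum>j\<in>UNIV. \<Sum>k\<in>UNIV. \<Sum>m\<in>UNIV. w $ j $ m * H $ m $ k * R j k)"
    by (rule sum.cong[OF refl], subst sum.swap) (simp add: mult_ac)
  also have "(\<Sum>j\<in>UNIV. \<Sum>k\<in>UNIV. H $ j $ k * R j k) = scal x"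
    by (simp add: scal_def R_def H_def)
  finally show ?thesis by simp
qed

lemma scal_const_imp_0:
  assumes "\<And>x. x \<in> U \<Longrightarrow> scal x = c" "U \<noteq> {}"
  shows "c = 0"
proof -
  obtain x where x: "x \<in> U" using assms(2) by blast
  have "pd i scal x = pd i (\<lambda>y. c) x" for i
    by (rule pd_cong_open[OF open_U x]) (rule assms(1))
  then have "dv scal x = 0" by (simp add: dv_def)
  then show ?thesis using dv_scal[OF x] assms(1)[OF x] by simp
qed

text \<open>\<open>(L\<^sub>v g)(X, Y) = g(\<nabla>\<^sub>X v, Y) + g(X, \<nabla>\<^sub>Y v) = 2 g(X, Y)\<close>: the terms with \<open>W\<close> coming from the metric and
  those coming from \<open>v\<close> cancel.\<close>

lemma lie_derivative_metric:
  assumes x: "x \<in> U"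
  shows "(\<Sum>k\<in>UNIV. v x $ k * pd k (\<lambda>y. G y $ i $ j) x
        + G x $ k $ j * pd i (\<lambda>y. v y $ k) x + G x $ i $ k * pd j (\<lambda>y. v y $ k) x) = 2 * G x $ i $ j"
proof -
  have "pd k (\<lambda>y. G y $ i $ j) x = (\<Sum>l\<in>UNIV. \<Gamma> k x $ l $ i * G x $ l $ j)
      + (\<Sum>l\<in>UNIV. G x $ i $ l * \<Gamma> k x $ l $ j)" for k
    using mpd_G[OF x, of k] by (simp add: vec_eq_iff mpd_def matrix_matrix_mult_def transpose_def)
  then have "(\<Sum>k\<in>UNIV. v x $ k * pd k (\<lambda>y. G y $ i $ j) x) =
      (\<Sum>k\<in>UNIV. \<Sum>l\<in>UNIV. v x $ k * (\<Gamma> k x $ l $ i * G x $ l $ j))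
          + (\<Sum>k\<in>UNIV. \<Sum>l\<in>UNIV. v x $ k * (G x $ i $ l * \<Gamma> k x $ l $ j))"
    by (simp add: distrib_left sum.distrib sum_distrib_left)
  also have "(\<Sum>k\<in>UNIV. \<Sum>l\<in>UNIV. v x $ k * (\<Gamma> k x $ l $ i * G x $ l $ j)) =
      (\<Sum>l\<in>UNIV. G x $ l $ j * W x $ l $ i)"
    by (subst sum.swap) (simp add: W_def sum_component sum_distrib_left mult_ac)
  also have "(\<Sum>k\<in>UNIV. \<Sum>l\<in>UNIV. v x $ k * (G x $ i $ l * \<Gamma> k x $ l $ j)) =
      (\<Sum>l\<in>UNIV. G x $ i $ l * W x $ l $ j)"
    by (subst sum.swap) (simp add: W_def sum_component sum_distrib_left mult_ac)
  finally show ?thesis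
    by (simp add: sum.distrib pd_v[OF x] right_diff_distrib sum_subtractf mult_delta_right)
qed

lemma smooth_energy: "smooth_on U (\<lambda>y. v y \<bullet> (G y *v v y) / 2)"
proof -
  have "smooth_on U (\<lambda>y. (1/2) * (\<Sum>a\<in>UNIV. v y $ a * (\<Sum>b\<in>UNIV. G y $ a $ b * v y $ b)))"
    by (intro smooth_on_mult smooth_on_sum smooth_on_const open_U v_smooth G_smooth)
  then show ?thesis by (simp add: inner_vec_def matrix_vector_mult_def)
qed

text \<open>The function \<open>g(v, v) / 2\<close> is a potential of \<open>v\<close>: its differential maps \<open>X\<close> to
  \<open>g(\<nabla>\<^sub>X v, v) = g(X, v)\<close>.\<close>

lemma pd_energy:
  assumes x: "x \<in> U"
  shows "pd i (\<lambda>y. v y \<bullet> (G y *v v y) / 2) x = (G x *v v x) $ i"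
proof -
  have dv: "(\<lambda>y. v y $ a) differentiable (at x)" and dG: "(\<lambda>y. G y $ a $ b) differentiable (at x)"
      for a b
    using smooth_on_differentiable[OF v_smooth x] smooth_on_differentiable[OF G_smooth x] by auto
  have d1: "(\<lambda>y. \<Sum>b\<in>UNIV. G y $ a $ b * v y $ b) differentiable (at x)" for a
    using dv dG by (intro differentiable_sum) auto
  have d2: "(\<lambda>y. \<Sum>a\<in>UNIV. v y $ a * (\<Sum>b\<in>UNIV. G y $ a $ b * v y $ b)) differentiable (at x)"
    using dv d1 by (intro differentiable_sum) auto
  have "pd i (\<lambda>y. v y \<bullet> (G y *v v y) / 2) x =
      pd i (\<lambda>y. (1/2) * (\<Sum>a\<in>UNIV. v y $ a * (\<Sum>b\<in>UNIV. G y $ a $ b * v y $ b))) x"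
    by (simp add: inner_vec_def matrix_vector_mult_def)
  also have "\<dots> = (1/2) * (vpd i v x \<bullet> (G x *v v x) + v x \<bullet> (mpd i G x *v v x)
      + v x \<bullet> (G x *v vpd i v x))"
    unfolding pd_cmult[OF d2] using dv dG d1
    by (simp add: pd_sum pd_mult differentiable_mult sum.distrib distrib_left
        inner_vec_def matrix_vector_mult_def vpd_def mpd_def)
  also have "\<dots> = (1/2) * (axis i 1 \<bullet> (G x *v v x) + v x \<bullet> (G x *v axis i 1))"
    unfolding vpd_v[OF x] mpd_G[OF x]
    using dot_lmul_matrix[of "G x *v v x" "\<Gamma> i x" "v x"]
    by (simp add: algebra_simps inner_diff_left inner_diff_right inner_add_right
        matrix_vector_mul_assoc[symmetric] inner_commute)
  also have "v x \<bullet> (G x *v axis i 1) = (v x v* G x) \<bullet> axis i 1" by (simp add: dot_lmul_matrix)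
  also have "v x v* G x = G x *v v x"
    using transpose_matrix_vector[of "G x" "v x"] G_sym[OF x] by simp
  finally show ?thesis by (simp add: inner_axis inner_axis')
qed

end

section \<open>Charts and transition maps\<close>

lemma cimage_iff: "x \<in> cimage c \<longleftrightarrow> (\<exists>p\<in>cdom c. x = coord c p)"
  by (auto simp: cimage_def)

lemma is_chart_inj: "is_chart X c \<Longrightarrow> inj_on (coord c) (cdom c)"
  using openin_subset[of X "cdom c"]
  by (auto simp: is_chart_def dest!: homeomorphic_imp_injective_map simp: topspace_subtopology
      Int_absorb1)

lemma cinv_coord: "is_chart X c \<Longrightarrow> p \<in> cdom c \<Longrightarrow> cinv c (coord c p) = p"
  by (simp add: cinv_def is_chart_inj)

lemma cinv_mem: "x \<in> cimage c \<Longrightarrow> cinv c x \<in> cdom c"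
  by (simp add: cinv_def cimage_def inv_into_into)

lemma coord_cinv: "x \<in> cimage c \<Longrightarrow> coord c (cinv c x) = x"
  by (simp add: cinv_def cimage_def f_inv_into_f)

lemma overlap_iff:
  "is_chart X c \<Longrightarrow> x \<in> overlap c c' \<longleftrightarrow> x \<in> cimage c \<and> cinv c x \<in> cdom c'"
  by (auto simp: overlap_def cimage_iff cinv_coord)

lemma overlap_self: "overlap c c = cimage c"
  by (simp add: overlap_def cimage_def)

lemma chart_image_open:
  assumes c: "is_chart X c" and S: "openin X S" "S \<subseteq> cdom c"
  shows "open (coord c ` S)"
proof -
  have "openin (subtopology X (cdom c)) S"
    using S by (metis inf.absorb_iff1 openin_subtopology)
  then have "openin (top_of_set (cimage c)) (coord c ` S)"
    using c homeomorphic_imp_open_map[of "subtopology X (cdom c)" "top_of_set (cimage c)" "coord c"]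
    by (simp add: is_chart_def open_map_def)
  then show ?thesis using c openin_open_trans by (auto simp: is_chart_def)
qed

lemma open_overlap: "is_chart X c \<Longrightarrow> is_chart X c' \<Longrightarrow> open (overlap c c')"
  unfolding overlap_def by (rule chart_image_open) (auto simp: is_chart_def)

lemma transition_mem:
  "is_chart X c \<Longrightarrow> is_chart X c' \<Longrightarrow> x \<in> overlap c c' \<Longrightarrow> transition c c' x \<in> overlap c' c"
  by (auto simp: overlap_def transition_def cinv_coord)

lemma transition_inverse:
  "is_chart X c \<Longrightarrow> is_chart X c' \<Longrightarrow> x \<in> overlap c c' \<Longrightarrow> transition c' c (transition c c' x) = x"
  by (auto simp: overlap_def transition_def cinv_coord)

lemma cinv_transition:
  "is_chart X c \<Longrightarrow> is_chart X c' \<Longrightarrow> x \<in> overlap c c' \<Longrightarrow> cinv c' (transition c c' x) = cinv c x"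
  by (auto simp: overlap_def transition_def cinv_coord)

lemma jacobian_self:
  assumes c: "is_chart X c" and x: "x \<in> cimage c"
  shows "jacobian c c x = mat 1"
proof -
  have "pd j (\<lambda>y. transition c c y $ i) x = pd j (\<lambda>y. y $ i) x" for i j
    by (rule pd_cong_open[where S = "cimage c"])
       (use c x in \<open>auto simp: is_chart_def transition_def coord_cinv\<close>)
  then show ?thesis by (auto simp: jacobian_def pd_component mat_def vec_eq_iff)
qed

lemma smooth_manifold_chart: "smooth_manifold X A \<Longrightarrow> c \<in> A \<Longrightarrow> is_chart X c"
  by (simp add: smooth_manifold_def)

lemma smooth_transition:
  "smooth_manifold X A \<Longrightarrow> c \<in> A \<Longrightarrow> c' \<in> A \<Longrightarrow> smooth_on (overlap c c') (\<lambda>x. transition c c' x $ i)"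
  by (simp add: smooth_manifold_def)

text \<open>The chain rule for \<open>transition c c2 = transition c1 c2 \<circ> transition c c1\<close>, an identity that holds on
  the part of the chart \<open>c\<close> where both sides are defined.\<close>

lemma jacobian_chain:
  assumes M: "smooth_manifold X A" and A: "c \<in> A" "c1 \<in> A" "c2 \<in> A"
    and x: "x \<in> overlap c c1" "x \<in> overlap c c2"
  shows "jacobian c c2 x = jacobian c1 c2 (transition c c1 x) ** jacobian c c1 x"
proof -
  note ch = smooth_manifold_chart[OF M]
  note c = ch[OF A(1)] and c1 = ch[OF A(2)] and c2 = ch[OF A(3)]
  have mem: "transition c c1 y \<in> overlap c1 c2" if "y \<in> overlap c c1" "y \<in> overlap c c2" for y
    using that transition_mem[OF c c1] cinv_transition[OF c c1]
    by (auto simp: overlap_iff[OF c] overlap_iff[OF c1])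
  have "pd j (\<lambda>y. transition c c2 y $ i) x =
      (\<Sum>l\<in>UNIV. pd l (\<lambda>z. transition c1 c2 z $ i) (transition c c1 x) * pd j (\<lambda>y. transition c c1
          y $ l) x)" for i j
  proof -
    have "pd j (\<lambda>y. transition c c2 y $ i) x = pd j (\<lambda>y. transition c1 c2 (transition c c1 y) $ i) x"
    proof (rule pd_cong_open[where S = "overlap c c1 \<inter> overlap c c2"])
      show "transition c c2 y $ i = transition c1 c2 (transition c c1 y) $ i"
        if "y \<in> overlap c c1 \<inter> overlap c c2" for y
        using that cinv_transition[OF c c1] by (simp add: transition_def)
    qed (use x open_overlap[OF c c1] open_overlap[OF c c2] in auto)
    also have "\<dots> = (\<Sum>l\<in>UNIV. pd l (\<lambda>z. transition c1 c2 z $ i) (transition c c1 x) * pd j (\<lambda>y.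
        transition c c1 y $ l) x)"
      by (rule pd_compose(2)[of "transition c c1"])
         (auto intro: smooth_on_differentiable[OF smooth_transition[OF M]] A x mem)
    finally show ?thesis .
  qed
  then show ?thesis by (simp add: jacobian_def matrix_matrix_mult_def vec_eq_iff)
qed

lemma compactin_chart_ball:
  assumes c: "is_chart X c" and S: "compact S" "S \<subseteq> cimage c"
  shows "compactin X (cinv c ` S)"
proof -
  have sub: "cinv c ` S \<subseteq> cdom c" using S cinv_mem by blast
  have dom: "cdom c \<subseteq> topspace X" using c by (simp add: is_chart_def openin_subset)
  have "coord c ` (cinv c ` S) = S" using S(2) coord_cinv[of _ c]
      by (force simp: image_image subset_iff)
  moreover have "compactin (top_of_set (cimage c)) S"
    using S by (simp add: compactin_subtopology)
  ultimately have "compactin (subtopology X (cdom c)) (cinv c ` S)"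
    using c sub dom homeomorphic_map_compactness_eq[of "subtopology X (cdom c)" "top_of_set
        (cimage c)" "coord c" "cinv c ` S"]
    by (auto simp: is_chart_def)
  then show ?thesis by (simp add: compactin_subtopology)
qed

section \<open>Global test fields\<close>

text \<open>Concurrency speaks about vector fields on the whole manifold, so a coordinate field has to be cut
  off by a bump function supported in a small closed ball of the chart and extended by 0. The
  extension is smooth because the ball is compact, hence closed in the Hausdorff space \<open>X\<close>, so
  every chart is covered by two open sets: its overlap with \<open>c\<close> and the complement of the ball.\<close>

lemma bump_coordinate_field:
  fixes X :: "'m topology" and A :: "('m, 'n::finite) chart set"
  assumes M: "smooth_manifold X A" and c: "c \<in> A" and a: "a \<in> cimage c"
  obtains Y s where "smooth_vector_field A Y" "Y c a = s *\<^sub>R axis i 1" "s \<noteq> (0::real)"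
proof -
  note ch = smooth_manifold_chart[OF M]
  note cc = ch[OF c]
  have "open (cimage c)" using cc by (simp add: is_chart_def)
  then obtain r where r: "r > 0" "cball a r \<subseteq> cimage c" using a open_contains_cball by blast
  obtain \<phi> :: "real^'n \<Rightarrow> real" where \<phi>: "\<And>S. open S \<Longrightarrow> smooth_on S \<phi>" "\<phi> a \<noteq> 0"
    "\<And>x. x \<notin> cball a r \<Longrightarrow> \<phi> x = 0"
    using smooth_bump_exists[OF r(1), of a] by metis
  define K where "K = cinv c ` cball a r"
  have K: "closedin X K"
    unfolding K_def using M
    by (intro compactin_imp_closedin compactin_chart_ball[OF cc] r) (auto simp: smooth_manifold_def)
  \<comment> \<open>The field \<open>\<phi> e\<^sub>i\<close> of the chart \<open>c\<close>, pushed forward to the chart \<open>c'\<close>.\<close>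
  define Y :: "('m, 'n) vfield" where "Y c' z = (if z \<in> overlap c' c
     then \<phi> (transition c' c z) *\<^sub>R (jacobian c c' (transition c' c z) *v axis i 1) else 0)" for c' z
  have Y0: "Y c' z = 0" if "z \<in> cimage c'" "cinv c' z \<notin> K" "c' \<in> A" for c' z
  proof (cases "z \<in> overlap c' c")
    case True
    then have "cinv c (transition c' c z) = cinv c' z" using cinv_transition[OF ch[OF that(3)] cc]
        by simp
    then have "transition c' c z \<notin> cball a r" using that(2) unfolding K_def by force
    then show ?thesis by (simp add: Y_def \<phi>)
  qed (simp add: Y_def)
  have "smooth_vector_field A Y"
    unfolding smooth_vector_field_def
  proof (intro conjI ballI allI)
    fix c' k
    assume c': "c' \<in> A"
    note cc' = ch[OF c']
    define V where "V = coord c' ` (cdom c' - K)"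
    have "openin X (cdom c' - K)" using cc' K by (auto simp: is_chart_def)
    then have V: "open V" unfolding V_def by (intro chart_image_open[OF cc']) auto
    have 1: "smooth_on (overlap c' c) (\<lambda>z. Y c' z $ k)"
    proof (rule smooth_on_cong[OF open_overlap[OF cc' cc]])
      have "smooth_on (overlap c c') (\<lambda>x. \<phi> x * pd i (\<lambda>y. transition c c' y $ k) x)"
        by (intro smooth_on_mult smooth_on_pd smooth_transition[OF M] \<phi>(1) open_overlap[OF cc cc'] c c')
      then show "smooth_on (overlap c' c) (\<lambda>z. (\<lambda>x. \<phi> x * pd i (\<lambda>y. transition c c' y $ k) x)
          (transition c' c z))"
        by (rule smooth_on_compose[OF open_overlap[OF cc' cc] smooth_transition[OF M c' c], rotated])
           (use transition_mem[OF cc' cc] in auto)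
    qed (simp add: Y_def matrix_vector_mult_basis column_def jacobian_def)
    have 2: "smooth_on V (\<lambda>z. Y c' z $ k)"
    proof (rule smooth_on_cong[OF V _ smooth_on_const[of _ 0]])
      fix z assume "z \<in> V"
      then have "z \<in> cimage c'" "cinv c' z \<notin> K" by (auto simp: V_def cimage_def cinv_coord[OF cc'])
      then show "0 = Y c' z $ k" using Y0 c' by simp
    qed
    have off: "cinv c' z \<notin> K" if "z \<in> cimage c'" "z \<notin> overlap c' c" for z
    proof
      assume "cinv c' z \<in> K"
      then obtain y where "y \<in> cimage c" "cinv c' z = cinv c y" using r(2) by (auto simp: K_def)
      then have "cinv c' z \<in> cdom c" by (simp add: cinv_mem)
      then show False using that by (simp add: overlap_iff[OF cc'])
    qed
    have "cimage c' \<subseteq> overlap c' c \<union> V"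
    proof
      fix z assume z: "z \<in> cimage c'"
      have "z \<in> V" if "z \<notin> overlap c' c"
        unfolding V_def using off[OF z that] cinv_mem[OF z] coord_cinv[OF z]
        by (intro image_eqI[of _ _ "cinv c' z"]) auto
      then show "z \<in> overlap c' c \<union> V" by blast
    qed
    then show "smooth_on (cimage c') (\<lambda>z. Y c' z $ k)"
      using smooth_on_Un[OF open_overlap[OF cc' cc] V 1 2] smooth_on_subset by blast
  next
    fix c1 c2 z assume A: "c1 \<in> A" "c2 \<in> A" and z: "z \<in> overlap c1 c2"
    note c1 = ch[OF A(1)] and c2 = ch[OF A(2)]
    have inv: "cinv c2 (transition c1 c2 z) = cinv c1 z" by (rule cinv_transition[OF c1 c2 z])
    have iff: "transition c1 c2 z \<in> overlap c2 c \<longleftrightarrow> z \<in> overlap c1 c"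
      using z transition_mem[OF c1 c2 z] inv by (simp add: overlap_iff[OF c1] overlap_iff[OF c2])
    have t: "transition c2 c (transition c1 c2 z) = transition c1 c z"
      by (simp add: transition_def[of c2 c] transition_def[of c1 c] inv)
    show "Y c2 (transition c1 c2 z) = jacobian c1 c2 z *v Y c1 z"
    proof (cases "z \<in> overlap c1 c")
      case True
      define x where "x = transition c1 c z"
      have x: "x \<in> overlap c c1" "transition c c1 x = z" "cinv c x = cinv c1 z"
        using transition_mem[OF c1 cc True] transition_inverse[OF c1 cc True] cinv_transition[OF
            c1 cc True]
        by (simp_all add: x_def)
      have "x \<in> overlap c c2" using x z by (auto simp: overlap_iff[OF cc] overlap_iff[OF c1])
      then have "jacobian c c2 x = jacobian c1 c2 z ** jacobian c c1 x"
        using jacobian_chain[OF M c A x(1)] x(2) by simp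
      then show ?thesis
        using True iff by (simp add: Y_def t x_def[symmetric] matrix_vector_mul_assoc
            matrix_vector_mult_scaleR)
    qed (simp add: Y_def iff)
  qed
  moreover have "Y c a = \<phi> a *\<^sub>R axis i 1"
    using a by (simp add: Y_def overlap_self transition_def coord_cinv jacobian_self[OF cc a])
  ultimately show ?thesis using that \<phi>(2) by blast
qed

text \<open>Evaluating the concurrency condition on a nonzero multiple of the \<open>i\<close>-th basis vector at \<open>x\<close>
  suffices, since the covariant derivative is tensorial in the direction.\<close>

lemma concurrent_pointwise:
  assumes M: "smooth_manifold X A" and conc: "concurrent A g v" and c: "c \<in> A" and x: "x \<in> cimage c"
  shows "pd i (\<lambda>y. v c y $ k) x + (\<Sum>j\<in>UNIV. christoffel (g c) k i j x * v c x $ j) = (if i =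
      k then 1 else 0)"
proof -
  obtain Y s where Y: "smooth_vector_field A Y" "Y c x = s *\<^sub>R axis i 1" "s \<noteq> 0"
    using bump_coordinate_field[OF M c x, of i] by blast
  have "covariant_derivative g Y v c x $ k = Y c x $ k"
    using conc Y(1) c x by (simp add: concurrent_def)
  then have "(\<Sum>l\<in>UNIV. s * axis i 1 $ l * (pd l (\<lambda>y. v c y $ k) x
      + (\<Sum>j\<in>UNIV. christoffel (g c) k l j x * v c x $ j))) = s * axis i 1 $ k"
    by (simp add: covariant_derivative_def Y(2))
  moreover have "s * axis i 1 $ l * b = (if l = i then s * b else 0)" for l b
    by (simp add: axis_def)
  ultimately have "s * (pd i (\<lambda>y. v c y $ k) x + (\<Sum>j\<in>UNIV. christoffel (g c) k i j x * v c x $ j)) =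
      s * axis i 1 $ k"
    by simp
  then show ?thesis using Y(3) by (auto simp: axis_def)
qed

section \<open>Concurrent Yamabe solitons\<close>

lemma pos_def_invertible:
  fixes M :: "real^'n::finite^'n"
  assumes "\<And>u. u \<noteq> 0 \<Longrightarrow> u \<bullet> (M *v u) > 0"
  shows "invertible M"
proof -
  have "\<forall>u. M *v u = 0 \<longrightarrow> u = 0" using assms by (metis inner_zero_right less_irrefl)
  then show ?thesis using matrix_left_invertible_ker invertible_left_inverse by blast
qed

lemma concurrent_patch_chart:
  assumes "riemannian_manifold X A g" "concurrent A g v" "c \<in> A"
  shows "concurrent_patch (cimage c) (g c) (v c)"
proof
  have M: "smooth_manifold X A" using assms by (simp add: riemannian_manifold_def)
  show "open (cimage c)" using smooth_manifold_chart[OF M assms(3)] by (simp add: is_chart_def)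
  show "smooth_on (cimage c) (\<lambda>x. g c x $ i $ j)" for i j
    using assms by (simp add: riemannian_manifold_def riemannian_metric_def)
  show "smooth_on (cimage c) (\<lambda>x. v c x $ i)" for i
    using assms by (simp add: concurrent_def smooth_vector_field_def)
  fix x assume x: "x \<in> cimage c"
  show "transpose (g c x) = g c x" "invertible (g c x)"
    using assms x by (auto simp: riemannian_manifold_def riemannian_metric_def intro!:
        pos_def_invertible)
  show "pd i (\<lambda>y. v c y $ k) x + (\<Sum>j\<in>UNIV. christoffel (g c) k i j x * v c x $ j) = (if i =
      k then 1 else 0)" for i k
    by (rule concurrent_pointwise[OF M assms(2,3) x])
qed

text \<open>Independence of the chart, which makes \<open>g(v, v) / 2\<close> a function on the manifold.\<close>

lemma energy_invariant:
  assumes "riemannian_metric A g" "smooth_vector_field A v" "c \<in> A" "c' \<in> A" "x \<in> overlap c c'"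
  shows "v c x \<bullet> (g c x *v v c x) =
    v c' (transition c c' x) \<bullet> (g c' (transition c c' x) *v v c' (transition c c' x))"
proof -
  define J where "J = jacobian c c' x"
  have "g c x = transpose J ** g c' (transition c c' x) ** J" "v c' (transition c c' x) = J *v v c x"
    using assms by (simp_all add: riemannian_metric_def smooth_vector_field_def J_def)
  then show ?thesis
    using dot_lmul_matrix[of "g c' (transition c c' x) *v (J *v v c x)" J "v c x"]
    by (simp add: matrix_vector_mul_assoc[symmetric] inner_commute)
qed

theorem corollary3p4:
  fixes X :: "'m topology"
    and A :: "('m, 'n::finite) chart set"
    and g :: "('m, 'n) bilinear_field"
    and v :: "('m, 'n) vfield"
    and \<rho> :: real
  assumes "yamabe_soliton X A g v \<rho>"
    and "concurrent A g v"
  shows "gradient_yamabe_soliton X A g v \<rho> \<and> expanding_yamabe_soliton X A g v \<rho> \<and>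
         (\<forall>c\<in>A. \<forall>x\<in>cimage c. scalar_curvature g c x = 0) \<and> \<rho> = -1"
proof -
  have R: "riemannian_manifold X A g" and v: "smooth_vector_field A v"
    and sol: "\<And>c x. c \<in> A \<Longrightarrow> x \<in> cimage c \<Longrightarrow>
        (scalar_curvature g c x - \<rho>) *\<^sub>R g c x = (1/2) *\<^sub>R lie_derivative v g c x"
    using assms(1) by (auto simp: yamabe_soliton_def)
  have M: "smooth_manifold X A" and g: "riemannian_metric A g"
    using R by (simp_all add: riemannian_manifold_def)
  note patch = concurrent_patch_chart[OF R assms(2)]
  have scal: "scalar_curvature g c x = \<rho> + 1" if c: "c \<in> A" and x: "x \<in> cimage c" for c x
  proof -
    interpret concurrent_patch "cimage c" "g c" "v c" by (rule patch[OF c])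
    have "lie_derivative v g c x = 2 *\<^sub>R g c x"
      by (simp add: vec_eq_iff lie_derivative_def lie_derivative_metric[OF x])
    then have "(scalar_curvature g c x - \<rho>) *\<^sub>R g c x = g c x" using sol[OF c x] by simp
    moreover have "g c x \<noteq> 0"
    proof
      assume "g c x = 0"
      moreover have "axis undefined 1 \<bullet> (g c x *v axis undefined 1) > 0"
        using g c x by (simp add: riemannian_metric_def)
      ultimately show False by simp
    qed
    ultimately have "scalar_curvature g c x - \<rho> = 1"
      by (metis scaleR_cancel_right scaleR_one)
    then show ?thesis by simp
  qed
  have \<rho>: "\<rho> = -1"
  proof -
    \<comment> \<open>A manifold is nonempty, so there is a point at which to read off \<open>\<rho> + 1 = 0\<close>.\<close>
    obtain p c where c: "c \<in> A" "p \<in> cdom c"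
      using M unfolding smooth_manifold_def by blast
    interpret concurrent_patch "cimage c" "g c" "v c" by (rule patch[OF c(1)])
    have "scal x = scalar_curvature g c x" for x by (simp add: scal_def scalar_curvature_def)
    then have "\<rho> + 1 = 0"
      using scal_const_imp_0[of "\<rho> + 1"] scal[OF c(1)] c(2) by (auto simp: cimage_def)
    then show ?thesis by simp
  qed
  define e where "e c x = v c x \<bullet> (g c x *v v c x) / 2" for c x
  \<comment> \<open>By \<open>energy_invariant\<close> the chart chosen here does not matter.\<close>
  define f where "f p = (let c = SOME c. c \<in> A \<and> p \<in> cdom c in e c (coord c p))" for p
  have f: "(f \<circ> cinv c) x = e c x" if c: "c \<in> A" and x: "x \<in> cimage c" for c x
  proof -
    define c' where "c' = (SOME c'. c' \<in> A \<and> cinv c x \<in> cdom c')"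
    have c': "c' \<in> A" "cinv c x \<in> cdom c'"
      unfolding c'_def using someI[of "\<lambda>c'. c' \<in> A \<and> cinv c x \<in> cdom c'" c] c cinv_mem[OF x] by auto
    have "x \<in> overlap c c'" using x c'(2) smooth_manifold_chart[OF M c] overlap_iff by blast
    from energy_invariant[OF g v c c'(1) this] show ?thesis
      by (simp add: f_def c'_def[symmetric] e_def transition_def)
  qed
  have "smooth_function A f \<and> (\<forall>c\<in>A. \<forall>x\<in>cimage c. v c x = gradient g f c x)"
    unfolding smooth_function_def
  proof (intro conjI ballI)
    fix c assume c: "c \<in> A"
    interpret concurrent_patch "cimage c" "g c" "v c" by (rule patch[OF c])
    show "smooth_on (cimage c) (f \<circ> cinv c)"
      by (rule smooth_on_cong[OF open_U _ smooth_energy]) (simp only: f[OF c] e_def)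
    fix x assume x: "x \<in> cimage c"
    have "pd i (f \<circ> cinv c) x = (g c x *v v c x) $ i" for i
      using pd_cong_open[OF open_U x, of "f \<circ> cinv c" "\<lambda>y. v c y \<bullet> (g c y *v v c y) / 2" i] f[OF c]
      by (simp add: pd_energy[OF x] e_def)
    then show "v c x = gradient g f c x"
      by (simp add: gradient_def matrix_vector_mul_assoc matrix_inv_mult[OF G_inv[OF x]])
  qed
  then show ?thesis
    using assms(1) scal \<rho> by (auto simp: gradient_yamabe_soliton_def expanding_yamabe_soliton_def)
qed

end
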